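(* Let $R$ be a compact Riemann surface of genus $g\geq 2$, let $N$ be a normal subgroup of $\pi_1(R)$ with $\pi_1(R)/N\cong\mathbb{Z}$, and let $\widetilde{R}\to R$ be the corresponding normal covering, so that $\mathbb{Z}$ acts holomorphically on $\widetilde{R}$ with $\widetilde{R}/\mathbb{Z}=R$. Let $X:=\mathbb{H}\times_{\mathbb{Z}}\widetilde{R}$ with the $\mathbb{R}$-action induced by $t\cdot(z,x)=(z+t,x)$ on $\mathbb{H}\times\widetilde{R}$, and let $X^*:=\mathbb{C}\times_{\mathbb{Z}}\widetilde{R}$ with the $\mathbb{C}$-action $t\cdot[z,x]=[z+t,x]$. Then the quotient $X/\mathbb{Z}$ (by $\mathbb{Z}\subset\mathbb{R}$) is biholomorphic to $\Delta^*\times R$; it is not holomorphically separable and in particular not Stein. The quotient $X^*/\mathbb{C}$ is biholomorphically equivalent to $\widetilde{R}/\mathbb{Z}=R$.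
   Context: $\mathbb{H}$ is the upper half plane and $\Delta^*=\Delta\setminus\{0\}$ the punctured unit disc. $\mathbb{H}\times_{\mathbb{Z}}\widetilde{R}$ and $\mathbb{C}\times_{\mathbb{Z}}\widetilde{R}$ denote the quotients of $\mathbb{H}\times\widetilde{R}$ and $\mathbb{C}\times\widetilde{R}$ by the diagonal $\mathbb{Z}$-action $m\cdot(z,x)=(z+m,m\cdot x)$; $[z,x]$ is the class of $(z,x)$. A complex manifold is holomorphically separable if its global holomorphic functions separate points. *)

theory Defs
  imports "HOL-Complex_Analysis.Complex_Analysis" "HOL-Homology.Homology" "HOL-Algebra.Bij"
begin

section \<open>Riemann surfaces\<close>

text \<open>A chart is a pair of its open domain and a complex coordinate on it; the coordinate is a total
  function of which only the values on the domain matter.\<close>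

record 'a surface =
  sf_top :: "'a topology"
  sf_atlas :: "('a set \<times> ('a \<Rightarrow> complex)) set"

text \<open>Connected, Hausdorff, of complex dimension one. Second countability is not required: by
  Rado's theorem it is automatic.\<close>

definition riemann_surface :: "'a surface \<Rightarrow> bool" where
  "riemann_surface M \<longleftrightarrow>
     topspace (sf_top M) \<noteq> {} \<and> connected_space (sf_top M) \<and> Hausdorff_space (sf_top M) \<and>
     (\<forall>(U, \<phi>) \<in> sf_atlas M. openin (sf_top M) U \<and> open (\<phi> ` U) \<and>
        homeomorphic_map (subtopology (sf_top M) U) (top_of_set (\<phi> ` U)) \<phi>) \<and>
     \<Union> (fst ` sf_atlas M) = topspace (sf_top M) \<and>
     (\<forall>(U, \<phi>) \<in> sf_atlas M. \<forall>(V, \<psi>) \<in> sf_atlas M.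
        (\<psi> \<circ> inv_into U \<phi>) holomorphic_on \<phi> ` (U \<inter> V))"

definition compact_riemann_surface :: "'a surface \<Rightarrow> bool" where
  "compact_riemann_surface M \<longleftrightarrow> riemann_surface M \<and> compact_space (sf_top M)"

text \<open>The genus of a compact Riemann surface is half the rank of its first integral homology group,
  which is free abelian.\<close>

definition has_genus :: "'a surface \<Rightarrow> nat \<Rightarrow> bool" where
  "has_genus M g \<longleftrightarrow> homology_group 1 (sf_top M) \<cong> free_Abelian_group {..<2 * g}"

text \<open>An open subset of the complex plane, with its single standard chart.\<close>

definition plane_domain :: "complex set \<Rightarrow> complex surface" where
  "plane_domain D = \<lparr>sf_top = top_of_set D, sf_atlas = {(D, \<lambda>z. z)}\<rparr>"

definition upper_half_plane :: "complex surface" where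
  "upper_half_plane = plane_domain {z. Im z > 0}"

definition complex_plane :: "complex surface" where
  "complex_plane = plane_domain UNIV"

definition punctured_disc :: "complex surface" where
  "punctured_disc = plane_domain (ball 0 1 - {0})"


section \<open>Complex spaces given by their structure sheaf\<close>

text \<open>A topological space together with, for each open set \<open>V\<close>, the set of holomorphic functions on
  \<open>V\<close>. Functions are total; \<open>sp_hol M V f\<close> is only meant for open \<open>V\<close> and only depends on
  the values of \<open>f\<close> on \<open>V\<close>.\<close>

record 'a cspace =
  sp_top :: "'a topology"
  sp_hol :: "'a set \<Rightarrow> ('a \<Rightarrow> complex) \<Rightarrow> bool"

abbreviation sp_points :: "'a cspace \<Rightarrow> 'a set" where
  "sp_points M \<equiv> topspace (sp_top M)"

definition surface_space :: "'a surface \<Rightarrow> 'a cspace" where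
  "surface_space M =
     \<lparr>sp_top = sf_top M,
      sp_hol = (\<lambda>W f. \<forall>(U, \<phi>) \<in> sf_atlas M. (f \<circ> inv_into U \<phi>) holomorphic_on \<phi> ` (U \<inter> W))\<rparr>"

text \<open>Holomorphic functions of two complex variables on an open set: the real differential exists and
  is complex linear at every point.\<close>

definition holomorphic2_on :: "(complex \<times> complex \<Rightarrow> complex) \<Rightarrow> (complex \<times> complex) set \<Rightarrow> bool" where
  "holomorphic2_on F W \<longleftrightarrow>
     (\<forall>w\<in>W. \<exists>a b. (F has_derivative (\<lambda>(h, k). a * h + b * k)) (at w))"

text \<open>The product complex surface: holomorphy is tested in the product charts.\<close>

definition product_space :: "'a surface \<Rightarrow> 'b surface \<Rightarrow> ('a \<times> 'b) cspace" where
  "product_space M N =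
     \<lparr>sp_top = prod_topology (sf_top M) (sf_top N),
      sp_hol = (\<lambda>W f. \<forall>(U, \<phi>) \<in> sf_atlas M. \<forall>(V, \<psi>) \<in> sf_atlas N.
         holomorphic2_on (\<lambda>(a, b). f (inv_into U \<phi> a, inv_into V \<psi> b))
           (map_prod \<phi> \<psi> ` ((U \<times> V) \<inter> W)))\<rparr>"

definition hol_map :: "'a cspace \<Rightarrow> 'b cspace \<Rightarrow> ('a \<Rightarrow> 'b) \<Rightarrow> bool" where
  "hol_map M N F \<longleftrightarrow> continuous_map (sp_top M) (sp_top N) F \<and>
     (\<forall>V f. openin (sp_top N) V \<longrightarrow> sp_hol N V f \<longrightarrow>
        sp_hol M {x \<in> sp_points M. F x \<in> V} (f \<circ> F))"

definition biholomorphic :: "'a cspace \<Rightarrow> 'b cspace \<Rightarrow> bool" where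
  "biholomorphic M N \<longleftrightarrow> (\<exists>F G. hol_map M N F \<and> hol_map N M G \<and>
     (\<forall>x \<in> sp_points M. G (F x) = x) \<and> (\<forall>y \<in> sp_points N. F (G y) = y))"

definition holomorphically_separable :: "'a cspace \<Rightarrow> bool" where
  "holomorphically_separable M \<longleftrightarrow> (\<forall>x \<in> sp_points M. \<forall>y \<in> sp_points M. x \<noteq> y \<longrightarrow>
     (\<exists>f. sp_hol M (sp_points M) f \<and> f x \<noteq> f y))"

definition hol_hull :: "'a cspace \<Rightarrow> 'a set \<Rightarrow> 'a set" where
  "hol_hull M K = {x \<in> sp_points M. \<forall>f B. sp_hol M (sp_points M) f \<longrightarrow>
     (\<forall>k\<in>K. norm (f k) \<le> B) \<longrightarrow> norm (f x) \<le> B}"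

definition holomorphically_convex :: "'a cspace \<Rightarrow> bool" where
  "holomorphically_convex M \<longleftrightarrow>
     (\<forall>K. compactin (sp_top M) K \<longrightarrow> compactin (sp_top M) (hol_hull M K))"

definition stein :: "'a cspace \<Rightarrow> bool" where
  "stein M \<longleftrightarrow> holomorphically_separable M \<and> holomorphically_convex M"


section \<open>Quotients by group actions\<close>

text \<open>The acting group is the type \<open>'g\<close>; points of the quotient are the orbits.\<close>

definition orbit_of :: "('g \<Rightarrow> 'a \<Rightarrow> 'a) \<Rightarrow> 'a \<Rightarrow> 'a set" where
  "orbit_of act x = range (\<lambda>g. act g x)"

definition orbit_topology :: "'a topology \<Rightarrow> ('g \<Rightarrow> 'a \<Rightarrow> 'a) \<Rightarrow> 'a set topology" where
  "orbit_topology X act = topology (\<lambda>V. V \<subseteq> orbit_of act ` topspace X \<and>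
     openin X {x \<in> topspace X. orbit_of act x \<in> V})"

lemma openin_orbit_topology:
  "openin (orbit_topology X act) V \<longleftrightarrow> V \<subseteq> orbit_of act ` topspace X \<and>
     openin X {x \<in> topspace X. orbit_of act x \<in> V}"
proof -
  let ?pre = "\<lambda>V. {x \<in> topspace X. orbit_of act x \<in> V}"
  have inter: "?pre (S \<inter> T) = ?pre S \<inter> ?pre T" for S T
    by auto
  have union: "?pre (\<Union>\<K>) = \<Union> (?pre ` \<K>)" for \<K>
    by auto
  have "istopology (\<lambda>V. V \<subseteq> orbit_of act ` topspace X \<and> openin X (?pre V))"
    unfolding istopology_def inter union by (auto intro!: openin_Union)
  then show ?thesis
    by (simp add: orbit_topology_def)
qed

text \<open>The quotient structure: holomorphic functions on the quotient are the functions whose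
  pullback is holomorphic, that is, the invariant holomorphic functions upstairs.\<close>

definition quotient_space :: "'a cspace \<Rightarrow> ('g \<Rightarrow> 'a \<Rightarrow> 'a) \<Rightarrow> 'a set cspace" where
  "quotient_space M act =
     \<lparr>sp_top = orbit_topology (sp_top M) act,
      sp_hol = (\<lambda>V f. sp_hol M {x \<in> sp_points M. orbit_of act x \<in> V} (f \<circ> orbit_of act))\<rparr>"


section \<open>Fundamental group and normal coverings\<close>

definition loops :: "'a topology \<Rightarrow> 'a \<Rightarrow> (real \<Rightarrow> 'a) set" where
  "loops X x0 = {p. pathin X p \<and> p 0 = x0 \<and> p 1 = x0}"

definition homotopic_loops_at :: "'a topology \<Rightarrow> 'a \<Rightarrow> (real \<Rightarrow> 'a) \<Rightarrow> (real \<Rightarrow> 'a) \<Rightarrow> bool" where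
  "homotopic_loops_at X x0 = homotopic_with (\<lambda>r. r 0 = x0 \<and> r 1 = x0) (top_of_set {0..1}) X"

definition loop_class :: "'a topology \<Rightarrow> 'a \<Rightarrow> (real \<Rightarrow> 'a) \<Rightarrow> (real \<Rightarrow> 'a) set" where
  "loop_class X x0 p = {q \<in> loops X x0. homotopic_loops_at X x0 p q}"

text \<open>Concatenation as in the library, whose version is restricted to topological type classes.\<close>

definition join_loops :: "(real \<Rightarrow> 'a) \<Rightarrow> (real \<Rightarrow> 'a) \<Rightarrow> real \<Rightarrow> 'a" where
  "join_loops p q = (\<lambda>t. if t \<le> 1/2 then p (2 * t) else q (2 * t - 1))"

definition fundamental_group :: "'a topology \<Rightarrow> 'a \<Rightarrow> (real \<Rightarrow> 'a) set monoid" where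
  "fundamental_group X x0 =
     \<lparr>carrier = loop_class X x0 ` loops X x0,
      monoid.mult = (\<lambda>A B. \<Union>p\<in>A. \<Union>q\<in>B. loop_class X x0 (join_loops p q)),
      one = loop_class X x0 (\<lambda>t. x0)\<rparr>"

text \<open>The image of the fundamental group of \<open>X\<close> at \<open>x0\<close> under the homomorphism induced by \<open>p\<close>.\<close>

definition induced_subgroup ::
    "'a topology \<Rightarrow> 'a \<Rightarrow> 'b topology \<Rightarrow> ('a \<Rightarrow> 'b) \<Rightarrow> (real \<Rightarrow> 'b) set set" where
  "induced_subgroup X x0 Y p = (\<lambda>c. loop_class Y (p x0) (p \<circ> c)) ` loops X x0"

definition covering_map :: "'a topology \<Rightarrow> 'b topology \<Rightarrow> ('a \<Rightarrow> 'b) \<Rightarrow> bool" where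
  "covering_map X Y p \<longleftrightarrow> continuous_map X Y p \<and> p ` topspace X = topspace Y \<and>
     (\<forall>y \<in> topspace Y. \<exists>V. openin Y V \<and> y \<in> V \<and>
        (\<exists>\<U>. \<Union>\<U> = {x \<in> topspace X. p x \<in> V} \<and> (\<forall>U\<in>\<U>. openin X U) \<and> pairwise disjnt \<U> \<and>
          (\<forall>U\<in>\<U>. homeomorphic_map (subtopology X U) (subtopology Y V) p)))"

definition deck_group :: "'a topology \<Rightarrow> ('a \<Rightarrow> 'b) \<Rightarrow> ('a \<Rightarrow> 'a) monoid" where
  "deck_group X p = BijGroup (topspace X)
     \<lparr>carrier := {f \<in> Bij (topspace X). homeomorphic_map X X f \<and> (\<forall>x\<in>topspace X. p (f x) = p x)}\<rparr>"

text \<open>A covering is normal (Galois) if the deck transformations act transitively on its fibres.\<close>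

definition normal_covering :: "'a topology \<Rightarrow> 'b topology \<Rightarrow> ('a \<Rightarrow> 'b) \<Rightarrow> bool" where
  "normal_covering X Y p \<longleftrightarrow> covering_map X Y p \<and>
     (\<forall>x\<in>topspace X. \<forall>y\<in>topspace X. p x = p y \<longrightarrow> (\<exists>f\<in>carrier (deck_group X p). f x = y))"


section \<open>The twisted products\<close>

definition diagonal_action :: "(int \<Rightarrow> 'b \<Rightarrow> 'b) \<Rightarrow> int \<Rightarrow> complex \<times> 'b \<Rightarrow> complex \<times> 'b" where
  "diagonal_action \<alpha> m = (\<lambda>(z, x). (z + of_int m, \<alpha> m x))"

definition twisted_product ::
    "complex surface \<Rightarrow> 'b surface \<Rightarrow> (int \<Rightarrow> 'b \<Rightarrow> 'b) \<Rightarrow> (complex \<times> 'b) set cspace" where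
  "twisted_product D S \<alpha> = quotient_space (product_space D S) (diagonal_action \<alpha>)"

definition translate :: "complex \<Rightarrow> (complex \<times> 'b) set \<Rightarrow> (complex \<times> 'b) set" where
  "translate t c = (\<lambda>(z, x). (z + t, x)) ` c"

text \<open>Translation therefore sends the class of \<open>(z, x)\<close> to the class of \<open>(z + t, x)\<close>.\<close>

lemma translate_orbit:
  "translate t (orbit_of (diagonal_action \<alpha>) (z, x)) = orbit_of (diagonal_action \<alpha>) (z + t, x)"
  by (auto simp: translate_def orbit_of_def diagonal_action_def image_image ac_simps)

end

theory Submission
  imports Defs
begin

text \<open>Both iterated quotients are quotients of the product of a plane domain with \<open>S\<close>, and a quotient
  of a complex space is determined up to biholomorphism by the fibres of the projection, as soon as
  holomorphic functions are those with holomorphic pullback. It therefore suffices to exhibit maps of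
  this kind with the right fibres: \<open>(z, x) \<mapsto> (exp (2 \<pi> \<i> z), p x)\<close> onto the product of the punctured
  disc and \<open>R\<close>, and \<open>(z, x) \<mapsto> x\<close> followed by the orbit map or by \<open>p\<close>. The deck transformations enter
  only through the fact that their orbits are the fibres of \<open>p\<close>. A product with the compact factor
  \<open>R\<close> is not holomorphically separable because, by the maximum principle, holomorphic functions
  are constant on the slices \<open>{z} \<times> R\<close>.\<close>

text \<open>No atlas is constructed on \<open>X\<close>, \<open>Xstar\<close> or their quotients:
  they are known only through topology and sheaf, so everything is checked upstairs on a product of
  two genuine surfaces. The twist disappears because the diagonal action of \<open>m\<close>
  followed by translation by \<open>-m\<close> is the action of \<open>m\<close> on the second
  factor alone. Integer translations and the diagonal action thus generate the full product action
  of two copies of the integers, whose orbits are the fibres of a product map. With complex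
  translations the first coordinate is swept away entirely, and only the orbit of the second
  remains. The delicate half of "holomorphic iff the pullback is" is the descent from above to
  below; local holomorphic sections provide it. As the maps are products of maps of surfaces, the
  sections come from the one-variable fact that injective holomorphic functions have holomorphic
  inverses, and no inverse function theorem in two variables enters. Only the projection to the
  second factor is of another kind; slices replace sections there.\<close>

definition quotient_hol_map :: "'a cspace \<Rightarrow> 'b cspace \<Rightarrow> ('a \<Rightarrow> 'b) \<Rightarrow> bool" where
  "quotient_hol_map M N q \<longleftrightarrow> quotient_map (sp_top M) (sp_top N) q \<and>
     (\<forall>V f. openin (sp_top N) V \<longrightarrow>
        sp_hol N V f = sp_hol M {x \<in> sp_points M. q x \<in> V} (f \<circ> q))"

text \<open>Functions are total, so nothing in \<open>cspace\<close> itself prevents \<open>sp_hol M W f\<close> from depending on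
  the values of \<open>f\<close> outside \<open>W\<close>.\<close>

definition hol_local :: "'a cspace \<Rightarrow> bool" where
  "hol_local M \<longleftrightarrow> (\<forall>W f g. openin (sp_top M) W \<longrightarrow> (\<forall>x\<in>W. f x = g x) \<longrightarrow>
     sp_hol M W f \<longrightarrow> sp_hol M W g)"

lemma topspace_orbit_topology:
  "topspace (orbit_topology X act) = orbit_of act ` topspace X"
proof
  show "topspace (orbit_topology X act) \<subseteq> orbit_of act ` topspace X"
    using openin_orbit_topology openin_topspace by blast
  have "{x \<in> topspace X. orbit_of act x \<in> orbit_of act ` topspace X} = topspace X"
    by blast
  then have "openin (orbit_topology X act) (orbit_of act ` topspace X)"
    by (simp add: openin_orbit_topology)
  then show "orbit_of act ` topspace X \<subseteq> topspace (orbit_topology X act)"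
    by (rule openin_subset)
qed

lemma quotient_hol_map_orbit_of: "quotient_hol_map M (quotient_space M act) (orbit_of act)"
  by (auto simp: quotient_hol_map_def quotient_space_def quotient_map_def
      topspace_orbit_topology openin_orbit_topology)

text \<open>The set where \<open>r\<close> lands in \<open>V\<close> is open in \<open>N\<close>, so
  the condition on \<open>q\<close> applies to it. This chains the two projections of an iterated
  orbit space.\<close>

lemma quotient_hol_map_compose:
  assumes "quotient_hol_map M N q" "quotient_hol_map N P r"
  shows "quotient_hol_map M P (r \<circ> q)"
proof -
  have q: "quotient_map (sp_top M) (sp_top N) q" and r: "quotient_map (sp_top N) (sp_top P) r"
    using assms by (auto simp: quotient_hol_map_def)
  have im: "q x \<in> sp_points N" if "x \<in> sp_points M" for x
    using q that by (auto simp: quotient_map_def)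
  have "sp_hol P V f = sp_hol M {x \<in> sp_points M. (r \<circ> q) x \<in> V} (f \<circ> (r \<circ> q))"
    if V: "openin (sp_top P) V" for V f
  proof -
    have o: "openin (sp_top N) {y \<in> sp_points N. r y \<in> V}"
      using r V openin_continuous_map_preimage quotient_imp_continuous_map by blast
    have "{x \<in> sp_points M. q x \<in> {y \<in> sp_points N. r y \<in> V}} =
        {x \<in> sp_points M. (r \<circ> q) x \<in> V}"
      using im by auto
    then show ?thesis
      using assms V o by (simp add: quotient_hol_map_def o_assoc)
  qed
  then show ?thesis
    using quotient_map_compose[OF q r] by (simp add: quotient_hol_map_def)
qed

text \<open>The universal property of the quotient \<open>q1\<close>: continuity and holomorphy of
  \<open>F\<close> may be tested on \<open>F \<circ> q1\<close>, which is \<open>q2\<close>. The two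
  agree only at points of \<open>M\<close>, so \<open>hol_local\<close> is what carries holomorphy
  from \<open>f \<circ> q2\<close> over to \<open>f \<circ> F \<circ> q1\<close>.\<close>

lemma same_fibres_hol_map:
  assumes loc: "hol_local M"
    and q1: "quotient_hol_map M N1 q1" and q2: "quotient_hol_map M N2 q2"
    and F: "\<And>x. x \<in> sp_points M \<Longrightarrow> F (q1 x) = q2 x"
  shows "hol_map N1 N2 F"
proof -
  have t1: "quotient_map (sp_top M) (sp_top N1) q1" and t2: "quotient_map (sp_top M) (sp_top N2) q2"
    using assms by (auto simp: quotient_hol_map_def)
  have im: "q1 x \<in> sp_points N1" if "x \<in> sp_points M" for x
    using t1 that by (auto simp: quotient_map_def)
  have "continuous_map (sp_top M) (sp_top N2) (F \<circ> q1)"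
    using F by (intro continuous_map_eq[OF quotient_imp_continuous_map[OF t2]]) auto
  then have c: "continuous_map (sp_top N1) (sp_top N2) F"
    by (rule continuous_compose_quotient_map[OF t1])
  have "sp_hol N1 {x \<in> sp_points N1. F x \<in> V} (f \<circ> F)"
    if V: "openin (sp_top N2) V" "sp_hol N2 V f" for V f
  proof -
    have o1: "openin (sp_top N1) {x \<in> sp_points N1. F x \<in> V}"
      using V c openin_continuous_map_preimage by blast
    have o2: "openin (sp_top M) {x \<in> sp_points M. q2 x \<in> V}"
      using V t2 openin_continuous_map_preimage quotient_imp_continuous_map by blast
    have eq: "{x \<in> sp_points M. q1 x \<in> {x \<in> sp_points N1. F x \<in> V}} =
        {x \<in> sp_points M. q2 x \<in> V}"
      using im F by auto
    have "sp_hol M {x \<in> sp_points M. q2 x \<in> V} (f \<circ> q2)"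
      using q2 V by (simp add: quotient_hol_map_def)
    moreover have "\<forall>x \<in> {x \<in> sp_points M. q2 x \<in> V}. (f \<circ> q2) x = (f \<circ> F \<circ> q1) x"
      using F by simp
    ultimately have "sp_hol M {x \<in> sp_points M. q2 x \<in> V} (f \<circ> F \<circ> q1)"
      using loc o2 unfolding hol_local_def by blast
    then show ?thesis
      using q1 o1 eq by (simp add: quotient_hol_map_def)
  qed
  with c show ?thesis
    by (simp add: hol_map_def)
qed

text \<open>Each map chooses a preimage and projects it the other way. Equal fibres make the result
  independent of the choice, and both directions are then instances of the universal
  property.\<close>

lemma biholomorphic_same_fibres:
  assumes loc: "hol_local M"
    and q1: "quotient_hol_map M N1 q1" and q2: "quotient_hol_map M N2 q2"
    and fib: "\<And>x y. x \<in> sp_points M \<Longrightarrow> y \<in> sp_points M \<Longrightarrow> q1 x = q1 y \<longleftrightarrow> q2 x = q2 y"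
  shows "biholomorphic N1 N2"
proof -
  define F where "F = q2 \<circ> inv_into (sp_points M) q1"
  define G where "G = q1 \<circ> inv_into (sp_points M) q2"
  have F: "F (q1 x) = q2 x" if "x \<in> sp_points M" for x
    using that fib[OF inv_into_into[OF imageI[OF that, of q1]] that] by (simp add: F_def f_inv_into_f)
  have G: "G (q2 x) = q1 x" if "x \<in> sp_points M" for x
    using that fib[OF inv_into_into[OF imageI[OF that, of q2]] that] by (simp add: G_def f_inv_into_f)
  have "sp_points N1 = q1 ` sp_points M" "sp_points N2 = q2 ` sp_points M"
    using q1 q2 by (auto simp: quotient_hol_map_def quotient_map_def)
  with F G show ?thesis
    unfolding biholomorphic_def
    by (intro exI[of _ F] exI[of _ G] conjI same_fibres_hol_map[OF loc q1 q2]
        same_fibres_hol_map[OF loc q2 q1]) auto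
qed

text \<open>A function separating \<open>G x\<close> from \<open>G y\<close> is pulled back along
  \<open>G\<close>, which is injective because \<open>F\<close> undoes it.\<close>

lemma holomorphically_separable_biholomorphic:
  assumes "biholomorphic M N" "holomorphically_separable M"
  shows "holomorphically_separable N"
proof -
  obtain F G where F: "hol_map M N F" and G: "hol_map N M G"
    and FG: "\<And>y. y \<in> sp_points N \<Longrightarrow> F (G y) = y"
    using assms(1) by (auto simp: biholomorphic_def)
  have im: "G y \<in> sp_points M" if "y \<in> sp_points N" for y
    using G that by (simp add: hol_map_def continuous_map_def Pi_iff)
  then have pre: "{y \<in> sp_points N. G y \<in> sp_points M} = sp_points N"
    by auto
  show ?thesis
    unfolding holomorphically_separable_def
  proof (intro ballI impI)
    fix x y
    assume xy: "x \<in> sp_points N" "y \<in> sp_points N" "x \<noteq> y"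
    then have "G x \<noteq> G y"
      using FG by metis
    then obtain f where f: "sp_hol M (sp_points M) f" "f (G x) \<noteq> f (G y)"
      using assms(2) im xy unfolding holomorphically_separable_def by blast
    have "sp_hol N (sp_points N) (f \<circ> G)"
      using G f(1) pre openin_topspace[of "sp_top M"] unfolding hol_map_def by force
    then show "\<exists>f. sp_hol N (sp_points N) f \<and> f x \<noteq> f y"
      using f(2) by (intro exI[of _ "f \<circ> G"]) simp
  qed
qed

section \<open>Charts of a Riemann surface\<close>

lemma chartD:
  assumes "riemann_surface M" "(U, \<phi>) \<in> sf_atlas M"
  shows "openin (sf_top M) U" "open (\<phi> ` U)"
    "homeomorphic_map (subtopology (sf_top M) U) (top_of_set (\<phi> ` U)) \<phi>"
    "inj_on \<phi> U" "U \<subseteq> topspace (sf_top M)"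
proof -
  show U: "openin (sf_top M) U" and "open (\<phi> ` U)"
    and h: "homeomorphic_map (subtopology (sf_top M) U) (top_of_set (\<phi> ` U)) \<phi>"
    using assms unfolding riemann_surface_def by blast+
  show sub: "U \<subseteq> topspace (sf_top M)"
    using U by (rule openin_subset)
  show "inj_on \<phi> U"
    using homeomorphic_imp_injective_map[OF h] sub by (simp add: Int_absorb1)
qed

lemma chart_exists:
  assumes "riemann_surface M" "x \<in> topspace (sf_top M)"
  obtains U \<phi> where "(U, \<phi>) \<in> sf_atlas M" "x \<in> U"
proof -
  have "x \<in> \<Union> (fst ` sf_atlas M)"
    using assms unfolding riemann_surface_def by simp
  then obtain c where "c \<in> sf_atlas M" "x \<in> fst c"
    by blast
  with that show thesis
    by (metis prod.collapse)
qed

lemma chart_open_image: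
  assumes "riemann_surface M" "(U, \<phi>) \<in> sf_atlas M" "openin (sf_top M) W"
  shows "open (\<phi> ` (U \<inter> W))"
proof -
  note c = chartD[OF assms(1,2)]
  have "openin (subtopology (sf_top M) U) (U \<inter> W)"
    using assms(3) by (simp add: openin_subtopology_Int2)
  then have "openin (top_of_set (\<phi> ` U)) (\<phi> ` (U \<inter> W))"
    using homeomorphic_imp_open_map[OF c(3)] unfolding open_map_def by blast
  then show ?thesis
    using c(2) openin_open_trans by blast
qed

lemma chart_open_preimage:
  assumes "riemann_surface M" "(U, \<phi>) \<in> sf_atlas M" "open T"
  shows "openin (sf_top M) {x \<in> U. \<phi> x \<in> T}"
proof -
  note c = chartD[OF assms(1,2)]
  have "continuous_map (subtopology (sf_top M) U) euclidean \<phi>"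
    using homeomorphic_imp_continuous_map[OF c(3)] by (simp add: continuous_map_in_subtopology)
  then have "openin (subtopology (sf_top M) U)
      {x \<in> topspace (subtopology (sf_top M) U). \<phi> x \<in> T}"
    using assms(3) open_openin[THEN iffD1] by (intro openin_continuous_map_preimage)
  moreover have "{x \<in> topspace (subtopology (sf_top M) U). \<phi> x \<in> T} = {x \<in> U. \<phi> x \<in> T}"
    using c(5) by auto
  ultimately show ?thesis
    using c(1) openin_trans_full by fastforce
qed

lemma chart_transition:
  assumes "riemann_surface M" "(U, \<phi>) \<in> sf_atlas M" "(V, \<psi>) \<in> sf_atlas M" "x \<in> U" "x \<in> V"
  shows "(\<psi> \<circ> inv_into U \<phi>) field_differentiable at (\<phi> x)"
proof -
  have "(\<psi> \<circ> inv_into U \<phi>) holomorphic_on \<phi> ` (U \<inter> V)"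
    using assms(1-3) unfolding riemann_surface_def by blast
  moreover have "open (\<phi> ` (U \<inter> V))"
    using assms chart_open_image chartD(1) by blast
  ultimately show ?thesis
    using assms(4,5) by (intro holomorphic_on_imp_differentiable_at) auto
qed

text \<open>Holomorphy at a point, without continuity: a single chart around \<open>h x\<close> is tested, and the
  values of \<open>h\<close> near \<open>x\<close> may lie outside its domain, where the coordinate is arbitrary.\<close>

definition complex_differentiable_at :: "'a surface \<Rightarrow> 'b surface \<Rightarrow> ('a \<Rightarrow> 'b) \<Rightarrow> 'a \<Rightarrow> bool" where
  "complex_differentiable_at M N h x \<longleftrightarrow> (\<exists>(A, a) \<in> sf_atlas N. h x \<in> A \<and>
     (\<forall>(U, \<phi>) \<in> sf_atlas M. x \<in> U \<longrightarrow> (a \<circ> h \<circ> inv_into U \<phi>) field_differentiable at (\<phi> x)))"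

text \<open>The pointwise condition behind the sheaf of \<open>product_space\<close>. Splitting it
  off lets holomorphy be carried through maps one point at a time, with no open sets to
  match.\<close>

definition holomorphic2_at :: "'a surface \<Rightarrow> 'b surface \<Rightarrow> ('a \<times> 'b \<Rightarrow> complex) \<Rightarrow> 'a \<times> 'b \<Rightarrow> bool" where
  "holomorphic2_at M N f = (\<lambda>(x, y). \<forall>(U, \<phi>) \<in> sf_atlas M. \<forall>(V, \<psi>) \<in> sf_atlas N. x \<in> U \<longrightarrow> y \<in> V \<longrightarrow>
     (\<exists>c d. ((\<lambda>(a, b). f (inv_into U \<phi> a, inv_into V \<psi> b)) has_derivative (\<lambda>(h, k). c * h + d * k))
        (at (\<phi> x, \<psi> y))))"

lemma ball_pair: "(\<forall>(x, y)\<in>A. P x y) \<longleftrightarrow> (\<forall>x y. (x, y) \<in> A \<longrightarrow> P x y)"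
  by auto

lemma complex_differentiable_atI:
  assumes "(A, a) \<in> sf_atlas N" "h x \<in> A"
    and "\<And>U \<phi>. (U, \<phi>) \<in> sf_atlas M \<Longrightarrow> x \<in> U \<Longrightarrow>
      (a \<circ> h \<circ> inv_into U \<phi>) field_differentiable at (\<phi> x)"
  shows "complex_differentiable_at M N h x"
  unfolding complex_differentiable_at_def ball_pair
  by (rule bexI[OF _ assms(1)]) (use assms(2,3) in simp)

lemma complex_differentiable_atE:
  assumes "complex_differentiable_at M N h x"
  obtains A a where "(A, a) \<in> sf_atlas N" "h x \<in> A"
    "\<And>U \<phi>. (U, \<phi>) \<in> sf_atlas M \<Longrightarrow> x \<in> U \<Longrightarrow>
      (a \<circ> h \<circ> inv_into U \<phi>) field_differentiable at (\<phi> x)"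
  using assms unfolding complex_differentiable_at_def ball_pair by auto

lemma holomorphic2_atI:
  assumes "\<And>U \<phi> V \<psi>. (U, \<phi>) \<in> sf_atlas M \<Longrightarrow> (V, \<psi>) \<in> sf_atlas N \<Longrightarrow> x \<in> U \<Longrightarrow> y \<in> V \<Longrightarrow>
     \<exists>c d. ((\<lambda>(a, b). f (inv_into U \<phi> a, inv_into V \<psi> b)) has_derivative (\<lambda>(h, k). c * h + d * k))
        (at (\<phi> x, \<psi> y))"
  shows "holomorphic2_at M N f (x, y)"
  using assms unfolding holomorphic2_at_def case_prod_conv ball_pair by simp

lemma holomorphic2_atE:
  assumes "holomorphic2_at M N f (x, y)" "(U, \<phi>) \<in> sf_atlas M" "(V, \<psi>) \<in> sf_atlas N" "x \<in> U" "y \<in> V"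
  obtains c d where "((\<lambda>(a, b). f (inv_into U \<phi> a, inv_into V \<psi> b)) has_derivative (\<lambda>(h, k). c * h + d * k))
        (at (\<phi> x, \<psi> y))"
proof -
  have "\<exists>c d. ((\<lambda>(a, b). f (inv_into U \<phi> a, inv_into V \<psi> b)) has_derivative (\<lambda>(h, k). c * h + d * k))
        (at (\<phi> x, \<psi> y))"
    using assms(1)[unfolded holomorphic2_at_def case_prod_conv ball_pair, rule_format, OF assms(2-5)] .
  with that show thesis
    by blast
qed

lemma complex_differentiable_at_ident:
  assumes "riemann_surface M" "x \<in> topspace (sf_top M)"
  shows "complex_differentiable_at M M (\<lambda>x. x) x"
proof -
  obtain A a where A: "(A, a) \<in> sf_atlas M" "x \<in> A"
    using chart_exists assms by metis
  show ?thesis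
  proof (rule complex_differentiable_atI[where A = A and a = a])
    show "(A, a) \<in> sf_atlas M" "x \<in> A"
      by (fact A)+
  next
    fix U \<phi> assume "(U, \<phi>) \<in> sf_atlas M" "x \<in> U"
    then have "(a \<circ> inv_into U \<phi>) field_differentiable at (\<phi> x)"
      by (rule chart_transition[OF assms(1) _ A(1) _ A(2)])
    then show "(a \<circ> (\<lambda>x. x) \<circ> inv_into U \<phi>) field_differentiable at (\<phi> x)"
      by (simp add: o_def)
  qed
qed

section \<open>Holomorphic functions on products\<close>

lemma openin_preimage_openin_subtopology:
  assumes "openin X W" "continuous_map (subtopology X W) Y h" "openin Y Z"
  shows "openin X {x \<in> W. h x \<in> Z}"
proof -
  have "openin (subtopology X W) {x \<in> topspace (subtopology X W). h x \<in> Z}"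
    using assms by (intro openin_continuous_map_preimage)
  moreover have "{x \<in> topspace (subtopology X W). h x \<in> Z} = {x \<in> W. h x \<in> Z}"
    using openin_subset[OF assms(1)] by auto
  ultimately show ?thesis
    using assms(1) openin_trans_full by metis
qed

text \<open>\<open>holomorphic2_on\<close> asks for a derivative in a full neighbourhood
  (\<open>at w\<close>, not within the set), so the condition splits into independent conditions at
  the points of \<open>W\<close>, whatever set \<open>W\<close> is.\<close>

lemma sp_hol_product_space:
   "sp_hol (product_space M N) W f \<longleftrightarrow> (\<forall>w\<in>W. holomorphic2_at M N f w)"
proof -
  let ?D = "\<lambda>U \<phi> V \<psi> w. \<exists>c d. ((\<lambda>(a, b). f (inv_into U \<phi> a, inv_into V \<psi> b)) has_derivative
     (\<lambda>(h, k). c * h + d * k)) (at w)"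
  have "sp_hol (product_space M N) W f \<longleftrightarrow> (\<forall>U \<phi> V \<psi>. (U, \<phi>) \<in> sf_atlas M \<longrightarrow> (V, \<psi>) \<in> sf_atlas N \<longrightarrow>
      (\<forall>w \<in> map_prod \<phi> \<psi> ` ((U \<times> V) \<inter> W). ?D U \<phi> V \<psi> w))"
    unfolding product_space_def cspace.simps ball_pair holomorphic2_on_def by blast
  also have "\<dots> \<longleftrightarrow> (\<forall>U \<phi> V \<psi>. (U, \<phi>) \<in> sf_atlas M \<longrightarrow> (V, \<psi>) \<in> sf_atlas N \<longrightarrow>
      (\<forall>x y. (x, y) \<in> W \<longrightarrow> x \<in> U \<longrightarrow> y \<in> V \<longrightarrow> ?D U \<phi> V \<psi> (\<phi> x, \<psi> y)))"
  proof -
    have "(\<forall>w \<in> map_prod \<phi> \<psi> ` ((U \<times> V) \<inter> W). P w) \<longleftrightarrow>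
        (\<forall>x y. (x, y) \<in> W \<longrightarrow> x \<in> U \<longrightarrow> y \<in> V \<longrightarrow> P (\<phi> x, \<psi> y))"
      for U \<phi> V \<psi> and P :: "complex \<times> complex \<Rightarrow> bool"
      unfolding ball_simps Ball_def split_paired_All by auto
    then show ?thesis by presburger
  qed
  also have "\<dots> \<longleftrightarrow> (\<forall>x y. (x, y) \<in> W \<longrightarrow> holomorphic2_at M N f (x, y))"
    unfolding holomorphic2_at_def case_prod_conv ball_pair by blast
  also have "\<dots> \<longleftrightarrow> (\<forall>w\<in>W. holomorphic2_at M N f w)"
    by (simp add: Ball_def split_paired_All)
  finally show ?thesis .
qed

text \<open>The inner derivative is diagonal, so complex linearity survives and each coefficient is
  merely scaled by one one-variable derivative.\<close>

lemma has_derivative_compose_pair: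
  fixes F :: "complex \<times> complex \<Rightarrow> complex"
  assumes F: "(F has_derivative (\<lambda>(h, k). c * h + d * k)) (at (G1 z, G2 w))"
    and G: "(G1 has_field_derivative p) (at z)" "(G2 has_field_derivative q) (at w)"
  shows "((\<lambda>(z, w). F (G1 z, G2 w)) has_derivative (\<lambda>(h, k). (c * p) * h + (d * q) * k)) (at (z, w))"
proof -
  have fst: "(fst has_derivative fst) (at (z, w))" and snd: "(snd has_derivative snd) (at (z, w))"
    by (auto intro!: derivative_eq_intros)
  have 1: "((\<lambda>x. G1 (fst x)) has_derivative (\<lambda>x. p * fst x)) (at (z, w))"
    using has_derivative_compose[OF fst, of G1 "(*) p"] G(1) by (simp add: has_field_derivative_def)
  have 2: "((\<lambda>x. G2 (snd x)) has_derivative (\<lambda>x. q * snd x)) (at (z, w))"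
    using has_derivative_compose[OF snd, of G2 "(*) q"] G(2) by (simp add: has_field_derivative_def)
  have "((\<lambda>x. F (G1 (fst x), G2 (snd x))) has_derivative
      (\<lambda>x. (\<lambda>(h, k). c * h + d * k) (p * fst x, q * snd x))) (at (z, w))"
    using has_derivative_compose[OF has_derivative_Pair[OF 1 2], of F "\<lambda>(h, k). c * h + d * k"] F by simp
  then show ?thesis
    by (simp add: case_prod_unfold mult.assoc)
qed

text \<open>Stated for maps that are only defined on open sets, since local sections of \<open>exp\<close> and of the
  covering are substituted for \<open>h1\<close> and \<open>h2\<close>.\<close>

lemma holomorphic2_at_compose:
  assumes M: "riemann_surface M1" "riemann_surface M2" and N: "riemann_surface N1" "riemann_surface N2"
    and O1: "openin (sf_top M1) O1" "x \<in> O1" "continuous_map (subtopology (sf_top M1) O1) (sf_top N1) h1"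
    and O2: "openin (sf_top M2) O2" "y \<in> O2" "continuous_map (subtopology (sf_top M2) O2) (sf_top N2) h2"
    and d: "complex_differentiable_at M1 N1 h1 x" "complex_differentiable_at M2 N2 h2 y"
    and f: "holomorphic2_at N1 N2 f (h1 x, h2 y)"
    and g: "\<And>x y. x \<in> O1 \<Longrightarrow> y \<in> O2 \<Longrightarrow> g (x, y) = f (h1 x, h2 y)"
  shows "holomorphic2_at M1 M2 g (x, y)"
proof -
  obtain A a where A: "(A, a) \<in> sf_atlas N1" "h1 x \<in> A"
    "\<And>U \<phi>. (U, \<phi>) \<in> sf_atlas M1 \<Longrightarrow> x \<in> U \<Longrightarrow> (a \<circ> h1 \<circ> inv_into U \<phi>) field_differentiable at (\<phi> x)"
    by (rule complex_differentiable_atE[OF d(1)]) (rule that)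
  obtain B b where B: "(B, b) \<in> sf_atlas N2" "h2 y \<in> B"
    "\<And>U \<phi>. (U, \<phi>) \<in> sf_atlas M2 \<Longrightarrow> y \<in> U \<Longrightarrow> (b \<circ> h2 \<circ> inv_into U \<phi>) field_differentiable at (\<phi> y)"
    by (rule complex_differentiable_atE[OF d(2)]) (rule that)
  define F where "F = (\<lambda>(u, v). f (inv_into A a u, inv_into B b v))"
  obtain c d where F: "(F has_derivative (\<lambda>(h, k). c * h + d * k)) (at (a (h1 x), b (h2 y)))"
    unfolding F_def by (rule holomorphic2_atE[OF f A(1) B(1) A(2) B(2)])
  \<comment> \<open>On all of \<open>O1\<close> the map may leave the chart domain \<open>A\<close>,
    where \<open>inv_into A a\<close> no longer undoes \<open>a\<close>. On \<open>P1\<close> and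
    \<open>P2\<close> the chart expression of \<open>f\<close> composed with those of
    \<open>h1\<close> and \<open>h2\<close> really is \<open>g\<close>.\<close>
  define P1 where "P1 = {x \<in> O1. h1 x \<in> A}"
  define P2 where "P2 = {x \<in> O2. h2 x \<in> B}"
  have P: "openin (sf_top M1) P1" "openin (sf_top M2) P2"
    unfolding P1_def P2_def
    using openin_preimage_openin_subtopology[OF O1(1,3) chartD(1)[OF N(1) A(1)]]
      openin_preimage_openin_subtopology[OF O2(1,3) chartD(1)[OF N(2) B(1)]] by simp_all
  have "\<exists>c d. ((\<lambda>(u, v). g (inv_into U \<phi> u, inv_into V \<psi> v)) has_derivative (\<lambda>(h, k). c * h + d * k))
        (at (\<phi> x, \<psi> y))"
    if U: "(U, \<phi>) \<in> sf_atlas M1" "x \<in> U" and V: "(V, \<psi>) \<in> sf_atlas M2" "y \<in> V" for U \<phi> V \<psi>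
  proof -
    let ?G1 = "a \<circ> h1 \<circ> inv_into U \<phi>" and ?G2 = "b \<circ> h2 \<circ> inv_into V \<psi>"
    have iU: "inj_on \<phi> U" and iV: "inj_on \<psi> V"
      using chartD(4) M U V by blast+
    obtain p q where p: "(?G1 has_field_derivative p) (at (\<phi> x))"
      and q: "(?G2 has_field_derivative q) (at (\<psi> y))"
      using A(3)[OF U] B(3)[OF V] unfolding field_differentiable_def by blast
    have v: "?G1 (\<phi> x) = a (h1 x)" "?G2 (\<psi> y) = b (h2 y)"
      using U V iU iV by simp_all
    have 3: "((\<lambda>(z, w). F (?G1 z, ?G2 w)) has_derivative
        (\<lambda>(h, k). (c * p) * h + (d * q) * k)) (at (\<phi> x, \<psi> y))"
    proof (rule has_derivative_compose_pair[where ?G1.0 = ?G1 and ?G2.0 = ?G2, OF _ p q])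
      show "(F has_derivative (\<lambda>(h, k). c * h + d * k)) (at (?G1 (\<phi> x), ?G2 (\<psi> y)))"
        unfolding v by (rule F)
    qed
    have "((\<lambda>(u, v). g (inv_into U \<phi> u, inv_into V \<psi> v)) has_derivative
        (\<lambda>(h, k). (c * p) * h + (d * q) * k)) (at (\<phi> x, \<psi> y))"
    proof (rule has_derivative_transform_within_open[OF 3])
      show "open (\<phi> ` (U \<inter> P1) \<times> \<psi> ` (V \<inter> P2))"
        by (intro open_Times chart_open_image[OF M(1) U(1) P(1)] chart_open_image[OF M(2) V(1) P(2)])
      show "(\<phi> x, \<psi> y) \<in> \<phi> ` (U \<inter> P1) \<times> \<psi> ` (V \<inter> P2)"
        using U V O1 O2 A B by (auto simp: P1_def P2_def)
      show "(\<lambda>(z, w). F (?G1 z, ?G2 w)) w = (\<lambda>(u, v). g (inv_into U \<phi> u, inv_into V \<psi> v)) w"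
        if "w \<in> \<phi> ` (U \<inter> P1) \<times> \<psi> ` (V \<inter> P2)" for w
        using that iU iV chartD(4)[OF N(1) A(1)] chartD(4)[OF N(2) B(1)]
        by (auto simp: P1_def P2_def g F_def)
    qed
    then show ?thesis by blast
  qed
  then show ?thesis
    by (intro holomorphic2_atI)
qed

text \<open>Around each point of \<open>W\<close> the functions agree on an open box, and
  composition with the identity of both factors, restricted to that box, passes from one to the
  other.\<close>

lemma hol_local_product_space:
  assumes M: "riemann_surface M" "riemann_surface N"
  shows "hol_local (product_space M N)"
  unfolding hol_local_def
proof (intro allI impI)
  fix W f g
  assume W: "openin (sp_top (product_space M N)) W" and fg: "\<forall>x\<in>W. f x = g x"
    and f: "sp_hol (product_space M N) W f"
  have W': "openin (prod_topology (sf_top M) (sf_top N)) W"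
    using W by (simp add: product_space_def)
  then have sub: "W \<subseteq> topspace (sf_top M) \<times> topspace (sf_top N)"
    using openin_subset by fastforce
  show "sp_hol (product_space M N) W g"
    unfolding sp_hol_product_space
  proof
    fix w assume "w \<in> W"
    moreover obtain x y where "w = (x, y)" by (cases w)
    ultimately have w: "(x, y) \<in> W" "w = (x, y)" by auto
    obtain O1 O2 where O: "openin (sf_top M) O1" "openin (sf_top N) O2" "x \<in> O1" "y \<in> O2" "O1 \<times> O2 \<subseteq> W"
      using W' w(1) unfolding openin_prod_topology_alt by metis
    have xy: "x \<in> topspace (sf_top M)" "y \<in> topspace (sf_top N)"
      using w sub by auto
    have "holomorphic2_at M N f (x, y)"
      using f w(1) unfolding sp_hol_product_space by blast
    moreover have "g (x, y) = f (x, y)" if "x \<in> O1" "y \<in> O2" for x y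
      using that O(5) fg by (simp add: subset_iff)
    moreover have id: "continuous_map (subtopology X U) X (\<lambda>x. x)" for X :: "'x topology" and U
      by (simp add: continuous_map_from_subtopology)
    ultimately show "holomorphic2_at M N g w"
      unfolding w(2)
      using holomorphic2_at_compose[OF M M O(1,3) id O(2,4) id
          complex_differentiable_at_ident[OF M(1) xy(1)] complex_differentiable_at_ident[OF M(2) xy(2)]]
      by metis
  qed
qed

text \<open>Given by holomorphic local sections through every point of \<open>M\<close>.\<close>

definition local_biholomorphism :: "'a surface \<Rightarrow> 'b surface \<Rightarrow> ('a \<Rightarrow> 'b) \<Rightarrow> bool" where
  "local_biholomorphism M N h \<longleftrightarrow>
     continuous_map (sf_top M) (sf_top N) h \<and>
     (\<forall>x \<in> topspace (sf_top M). complex_differentiable_at M N h x) \<and>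
     (\<forall>x \<in> topspace (sf_top M). \<exists>V s. openin (sf_top N) V \<and> h x \<in> V \<and>
        continuous_map (subtopology (sf_top N) V) (sf_top M) s \<and> s (h x) = x \<and>
        (\<forall>y\<in>V. h (s y) = y \<and> complex_differentiable_at N M s y))"

lemma local_biholomorphism_section:
  assumes "local_biholomorphism M N h" "x \<in> topspace (sf_top M)"
  obtains V s where "openin (sf_top N) V" "h x \<in> V"
    "continuous_map (subtopology (sf_top N) V) (sf_top M) s" "s (h x) = x"
    "\<And>y. y \<in> V \<Longrightarrow> h (s y) = y" "\<And>y. y \<in> V \<Longrightarrow> complex_differentiable_at N M s y"
proof -
  have "\<exists>V s. openin (sf_top N) V \<and> h x \<in> V \<and>
        continuous_map (subtopology (sf_top N) V) (sf_top M) s \<and> s (h x) = x \<and>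
        (\<forall>y\<in>V. h (s y) = y \<and> complex_differentiable_at N M s y)"
    using assms unfolding local_biholomorphism_def by simp
  with that show thesis
    by metis
qed

text \<open>Around \<open>h x\<close> the image of \<open>W\<close> contains the points whose
  section value lies in \<open>W\<close>, an open set by continuity of the section.\<close>

lemma local_biholomorphism_open_map:
  assumes h: "local_biholomorphism M N h"
  shows "open_map (sf_top M) (sf_top N) h"
  unfolding open_map_def
proof (intro allI impI)
  fix W assume W: "openin (sf_top M) W"
  show "openin (sf_top N) (h ` W)"
  proof (subst openin_subopen, intro ballI)
    fix y assume "y \<in> h ` W"
    then obtain x where x: "x \<in> W" "y = h x" by blast
    then have "x \<in> topspace (sf_top M)"
      using openin_subset[OF W] by blast
    then obtain V s where V: "openin (sf_top N) V" "h x \<in> V"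
        "continuous_map (subtopology (sf_top N) V) (sf_top M) s" "s (h x) = x"
        "\<And>y. y \<in> V \<Longrightarrow> h (s y) = y"
      by (rule local_biholomorphism_section[OF h]) (rule that)
    have "openin (sf_top N) {y \<in> V. s y \<in> W}"
      by (rule openin_preimage_openin_subtopology[OF V(1,3) W])
    moreover have "{y \<in> V. s y \<in> W} \<subseteq> h ` W"
      using V(5) by force
    ultimately show "\<exists>T. openin (sf_top N) T \<and> y \<in> T \<and> T \<subseteq> h ` W"
      using x V(2,4) by (intro exI[of _ "{y \<in> V. s y \<in> W}"]) simp
  qed
qed

text \<open>A continuous open surjection is a quotient map, and openness can be checked on boxes.
  For the sheaves, pulling back is composition with \<open>h1\<close> and \<open>h2\<close>, and
  descending is composition with local sections of both.\<close>

lemma quotient_hol_map_map_prod: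
  assumes M: "riemann_surface M1" "riemann_surface M2" and N: "riemann_surface N1" "riemann_surface N2"
    and h1: "local_biholomorphism M1 N1 h1" "h1 ` topspace (sf_top M1) = topspace (sf_top N1)"
    and h2: "local_biholomorphism M2 N2 h2" "h2 ` topspace (sf_top M2) = topspace (sf_top N2)"
  shows "quotient_hol_map (product_space M1 M2) (product_space N1 N2) (map_prod h1 h2)"
proof -
  let ?X = "prod_topology (sf_top M1) (sf_top M2)" and ?Y = "prod_topology (sf_top N1) (sf_top N2)"
  have top: "sp_top (product_space M1 M2) = ?X" "sp_top (product_space N1 N2) = ?Y"
    by (simp_all add: product_space_def)
  have c: "continuous_map (sf_top M1) (sf_top N1) h1" "continuous_map (sf_top M2) (sf_top N2) h2"
    using h1 h2 unfolding local_biholomorphism_def by simp_all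
  have cont: "continuous_map ?X ?Y (map_prod h1 h2)"
    using c unfolding map_prod_def by (simp add: continuous_map_prod_top)
  have "open_map ?X ?Y (map_prod h1 h2)"
    unfolding open_map_def
  proof (intro allI impI)
    fix W assume W: "openin ?X W"
    show "openin ?Y (map_prod h1 h2 ` W)"
    proof (subst openin_subopen, intro ballI)
      fix w assume "w \<in> map_prod h1 h2 ` W"
      then obtain x y where xy: "(x, y) \<in> W" "w = (h1 x, h2 y)"
        by auto
      obtain U V where UV: "openin (sf_top M1) U" "openin (sf_top M2) V" "x \<in> U" "y \<in> V" "U \<times> V \<subseteq> W"
        using W xy(1) unfolding openin_prod_topology_alt by metis
      have "openin ?Y (h1 ` U \<times> h2 ` V)"
        using UV(1,2) local_biholomorphism_open_map[OF h1(1)] local_biholomorphism_open_map[OF h2(1)]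
        by (simp add: open_map_def openin_prod_Times_iff)
      moreover have "h1 ` U \<times> h2 ` V \<subseteq> map_prod h1 h2 ` W"
        using UV(5) by (simp add: map_prod_surj_on subset_iff image_iff) force
      ultimately show "\<exists>T. openin ?Y T \<and> w \<in> T \<and> T \<subseteq> map_prod h1 h2 ` W"
        using UV(3,4) xy(2) by (intro exI[of _ "h1 ` U \<times> h2 ` V"]) simp
    qed
  qed
  moreover have "map_prod h1 h2 ` topspace ?X = topspace ?Y"
    using h1(2) h2(2) by (simp add: map_prod_surj_on)
  ultimately have q: "quotient_map ?X ?Y (map_prod h1 h2)"
    by (intro continuous_open_imp_quotient_map cont)
  have "sp_hol (product_space N1 N2) V f =
      sp_hol (product_space M1 M2) {x \<in> topspace ?X. map_prod h1 h2 x \<in> V} (f \<circ> map_prod h1 h2)"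
    if V: "openin ?Y V" for V f
  proof -
    have "holomorphic2_at M1 M2 (f \<circ> map_prod h1 h2) (x, y)"
      if "x \<in> topspace (sf_top M1)" "y \<in> topspace (sf_top M2)" "holomorphic2_at N1 N2 f (h1 x, h2 y)" for x y
    proof (rule holomorphic2_at_compose[where ?h1.0 = h1 and ?h2.0 = h2 and f = f, OF M N openin_topspace that(1) _ openin_topspace that(2) _ _ _ that(3)])
      show "complex_differentiable_at M1 N1 h1 x" "complex_differentiable_at M2 N2 h2 y"
        using h1 h2 that unfolding local_biholomorphism_def by simp_all
    qed (use c in simp_all)
    moreover have "holomorphic2_at N1 N2 f (h1 x, h2 y)"
      if x: "x \<in> topspace (sf_top M1)" and y: "y \<in> topspace (sf_top M2)"
        and g: "holomorphic2_at M1 M2 (f \<circ> map_prod h1 h2) (x, y)" for x y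
    proof -
      obtain V s where V: "openin (sf_top N1) V" "h1 x \<in> V"
        "continuous_map (subtopology (sf_top N1) V) (sf_top M1) s" "s (h1 x) = x"
        "\<And>y. y \<in> V \<Longrightarrow> h1 (s y) = y" "\<And>y. y \<in> V \<Longrightarrow> complex_differentiable_at N1 M1 s y"
        by (rule local_biholomorphism_section[OF h1(1) x]) (rule that)
      obtain U t where U: "openin (sf_top N2) U" "h2 y \<in> U"
        "continuous_map (subtopology (sf_top N2) U) (sf_top M2) t" "t (h2 y) = y"
        "\<And>y. y \<in> U \<Longrightarrow> h2 (t y) = y" "\<And>y. y \<in> U \<Longrightarrow> complex_differentiable_at N2 M2 t y"
        by (rule local_biholomorphism_section[OF h2(1) y]) (rule that)
      \<comment> \<open>Near \<open>(h1 x, h2 y)\<close> the function \<open>f\<close> is its own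
        pullback composed with the pair of sections \<open>s\<close> and \<open>t\<close>, since
        \<open>h1\<close> and \<open>h2\<close> undo them.\<close>
      show ?thesis
      proof (rule holomorphic2_at_compose[where ?h1.0 = s and ?h2.0 = t, OF N M V(1-3) U(1-3) V(6)[OF V(2)] U(6)[OF U(2)]])
        show "holomorphic2_at M1 M2 (f \<circ> map_prod h1 h2) (s (h1 x), t (h2 y))"
          using g V(4) U(4) by simp
      qed (use V(5) U(5) in simp)
    qed
    ultimately have eq: "holomorphic2_at M1 M2 (f \<circ> map_prod h1 h2) (x, y) \<longleftrightarrow>
        holomorphic2_at N1 N2 f (h1 x, h2 y)"
      if "x \<in> topspace (sf_top M1)" "y \<in> topspace (sf_top M2)" for x y
      using that by blast
    have im: "V = map_prod h1 h2 ` {x \<in> topspace ?X. map_prod h1 h2 x \<in> V}"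
    proof -
      have "V = q ` {x \<in> X. q x \<in> V}" if "q ` X = Y" "V \<subseteq> Y" for X Y and q :: "'a \<times> 'b \<Rightarrow> 'c \<times> 'd"
        using that by blast
      from this[OF quotient_imp_surjective_map[OF q] openin_subset[OF V]] show ?thesis .
    qed
    have "sp_hol (product_space N1 N2) V f \<longleftrightarrow>
        (\<forall>x \<in> {x \<in> topspace ?X. map_prod h1 h2 x \<in> V}. holomorphic2_at N1 N2 f (map_prod h1 h2 x))"
      unfolding sp_hol_product_space by (subst im) simp
    also have "\<dots> \<longleftrightarrow> (\<forall>x \<in> {x \<in> topspace ?X. map_prod h1 h2 x \<in> V}.
        holomorphic2_at M1 M2 (f \<circ> map_prod h1 h2) x)"
      using eq by (intro ball_cong) auto
    finally show ?thesis
      unfolding sp_hol_product_space .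
  qed
  with q show ?thesis
    by (simp add: quotient_hol_map_def top)
qed

section \<open>Holomorphic maps between surfaces and their local inverses\<close>

text \<open>\<open>holomorphic_on\<close> means differentiability within the set; this is
  differentiability at the point because the chart images of an open \<open>W\<close> are
  open.\<close>

lemma sp_hol_surface_space:
  assumes M: "riemann_surface M" and W: "openin (sf_top M) W"
  shows "sp_hol (surface_space M) W f \<longleftrightarrow> (\<forall>x\<in>W. \<forall>U \<phi>. (U, \<phi>) \<in> sf_atlas M \<longrightarrow> x \<in> U \<longrightarrow>
     (f \<circ> inv_into U \<phi>) field_differentiable at (\<phi> x))"
proof -
  have "(f \<circ> inv_into U \<phi>) holomorphic_on \<phi> ` (U \<inter> W) \<longleftrightarrow>
      (\<forall>x\<in>W. x \<in> U \<longrightarrow> (f \<circ> inv_into U \<phi>) field_differentiable at (\<phi> x))"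
    if U: "(U, \<phi>) \<in> sf_atlas M" for U \<phi>
  proof -
    have o: "open (\<phi> ` (U \<inter> W))"
      by (rule chart_open_image[OF M U W])
    have "(f \<circ> inv_into U \<phi>) holomorphic_on \<phi> ` (U \<inter> W) \<longleftrightarrow>
      (\<forall>w\<in>\<phi> ` (U \<inter> W). (f \<circ> inv_into U \<phi>) field_differentiable at w)"
      using o by (simp add: holomorphic_on_def at_within_open[OF _ o] del: ball_simps)
    then show ?thesis
      by auto
  qed
  then show ?thesis
    unfolding surface_space_def cspace.simps ball_pair by blast
qed

text \<open>\<open>hol_map\<close> only speaks of pulling back functions. The coordinate
  \<open>a\<close> of a chart around \<open>h x\<close> is itself holomorphic on its domain, and its
  pullback is \<open>h\<close> read in that chart.\<close>

lemma hol_map_complex_differentiable_at: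
  assumes M: "riemann_surface M" and N: "riemann_surface N"
    and h: "hol_map (surface_space M) (surface_space N) h" and x: "x \<in> topspace (sf_top M)"
  shows "complex_differentiable_at M N h x"
proof -
  have c: "continuous_map (sf_top M) (sf_top N) h"
    using h by (simp add: hol_map_def surface_space_def)
  have "h x \<in> topspace (sf_top N)"
    using c x by (simp add: continuous_map_def Pi_iff)
  then obtain A a where A: "(A, a) \<in> sf_atlas N" "h x \<in> A"
    using chart_exists N by metis
  note oA = chartD(1)[OF N A(1)]
  have "sp_hol (surface_space N) A a"
    unfolding sp_hol_surface_space[OF N oA] using chart_transition[OF N _ A(1)] by blast
  then have "sp_hol (surface_space M) {x \<in> topspace (sf_top M). h x \<in> A} (a \<circ> h)"
    using h oA unfolding hol_map_def by (simp add: surface_space_def)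
  moreover have "openin (sf_top M) {x \<in> topspace (sf_top M). h x \<in> A}"
    by (rule openin_continuous_map_preimage[OF c oA])
  ultimately have d: "\<And>U \<phi>. (U, \<phi>) \<in> sf_atlas M \<Longrightarrow> x \<in> U \<Longrightarrow> (a \<circ> h \<circ> inv_into U \<phi>) field_differentiable at (\<phi> x)"
    using x A(2) by (simp add: sp_hol_surface_space[OF M])
  show ?thesis
    by (rule complex_differentiable_atI[where A = A and a = a, OF A d])
qed

text \<open>Read in charts, an injective holomorphic function of one variable is biholomorphic onto
  its open image. Local injectivity therefore already yields the sections, with no condition on a
  derivative.\<close>

lemma local_biholomorphismI:
  assumes M: "riemann_surface M" and N: "riemann_surface N"
    and c: "continuous_map (sf_top M) (sf_top N) h"
    and d: "\<And>x. x \<in> topspace (sf_top M) \<Longrightarrow> complex_differentiable_at M N h x"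
    and inj: "\<And>x. x \<in> topspace (sf_top M) \<Longrightarrow> \<exists>W. openin (sf_top M) W \<and> x \<in> W \<and> inj_on h W"
  shows "local_biholomorphism M N h"
proof -
  have "\<exists>V s. openin (sf_top N) V \<and> h x \<in> V \<and>
        continuous_map (subtopology (sf_top N) V) (sf_top M) s \<and> s (h x) = x \<and>
        (\<forall>y\<in>V. h (s y) = y \<and> complex_differentiable_at N M s y)"
    if x: "x \<in> topspace (sf_top M)" for x
  proof -
    obtain W0 where W0: "openin (sf_top M) W0" "x \<in> W0" "inj_on h W0"
      using inj x by blast
    obtain U \<phi> where U: "(U, \<phi>) \<in> sf_atlas M" "x \<in> U"
      using chart_exists M x by metis
    have "h x \<in> topspace (sf_top N)"
      using c x by (simp add: continuous_map_def Pi_iff)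
    then obtain A a where A: "(A, a) \<in> sf_atlas N" "h x \<in> A"
      using chart_exists N by metis
    note cU = chartD[OF M U(1)] and cA = chartD[OF N A(1)]
    \<comment> \<open>Small enough for \<open>h\<close> to be injective and to stay inside the chart
      \<open>A\<close>, so that \<open>g\<close>, which is \<open>h\<close> in coordinates, is
      injective on \<open>P\<close>.\<close>
    define W where "W = W0 \<inter> {z \<in> topspace (sf_top M). h z \<in> A}"
    have W: "openin (sf_top M) W"
      unfolding W_def by (intro openin_Int W0(1) openin_continuous_map_preimage[OF c cA(1)])
    have Wx: "x \<in> W" and WA: "\<And>z. z \<in> W \<Longrightarrow> h z \<in> A" and Winj: "inj_on h W"
      using W0 x A(2) by (auto simp: W_def inj_on_def)
    define P where "P = \<phi> ` (U \<inter> W)"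
    have P: "open P"
      unfolding P_def by (rule chart_open_image[OF M U(1) W])
    define g where "g = a \<circ> h \<circ> inv_into U \<phi>"
    have inv: "inv_into U \<phi> (\<phi> z) = z" if "z \<in> U" for z
      using cU(4) that by simp
    have inva: "inv_into A a (a z) = z" if "z \<in> A" for z
      using cA(4) that by simp
    have "g field_differentiable at (\<phi> z)" if z: "z \<in> U" "z \<in> W" for z
    proof -
      have "z \<in> topspace (sf_top M)"
        using cU(5) z by blast
      \<comment> \<open>\<open>d\<close> speaks of some chart around \<open>h z\<close>, not of the
        fixed \<open>a\<close>. The transition from \<open>b\<close> to \<open>a\<close> converts,
        and the result equals \<open>g\<close> on \<open>Q\<close>, where \<open>h\<close> lands in
        \<open>B\<close>.\<close>
      then obtain B b where B: "(B, b) \<in> sf_atlas N" "h z \<in> B"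
        "(b \<circ> h \<circ> inv_into U \<phi>) field_differentiable at (\<phi> z)"
        using complex_differentiable_atE[OF d] U(1) z(1) by metis
      have "(a \<circ> inv_into B b) field_differentiable at (b (h z))"
        by (rule chart_transition[OF N B(1) A(1) B(2) WA[OF z(2)]])
      then have "((a \<circ> inv_into B b) \<circ> (b \<circ> h \<circ> inv_into U \<phi>)) field_differentiable at (\<phi> z)"
        using B(3) inv[OF z(1)] by (intro field_differentiable_compose) auto
      then obtain D where D: "(((a \<circ> inv_into B b) \<circ> (b \<circ> h \<circ> inv_into U \<phi>)) has_field_derivative D) (at (\<phi> z))"
        unfolding field_differentiable_def by blast
      define Q where "Q = \<phi> ` (U \<inter> {z \<in> topspace (sf_top M). h z \<in> B})"
      have "open Q"
        unfolding Q_def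
        by (intro chart_open_image[OF M U(1)] openin_continuous_map_preimage[OF c chartD(1)[OF N B(1)]])
      moreover have "\<phi> z \<in> Q"
        using z B(2) cU(5) by (auto simp: Q_def)
      moreover have "((a \<circ> inv_into B b) \<circ> (b \<circ> h \<circ> inv_into U \<phi>)) w = g w" if "w \<in> Q" for w
        using that chartD(4)[OF N B(1)] inv by (auto simp: Q_def g_def)
      ultimately have "(g has_field_derivative D) (at (\<phi> z))"
        using has_field_derivative_transform_within_open[OF D] by blast
      then show ?thesis
        unfolding field_differentiable_def by blast
    qed
    then have hol: "g holomorphic_on P"
      unfolding holomorphic_on_def P_def by (auto intro: field_differentiable_at_within)
    have gi: "inj_on g P"
    proof -
      have "z = z'" if "z \<in> U \<inter> W" "z' \<in> U \<inter> W" "g (\<phi> z) = g (\<phi> z')" for z z'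
      proof -
        have "a (h z) = a (h z')"
          using that inv by (simp add: g_def)
        then have "h z = h z'"
          using that WA by (intro inj_onD[OF cA(4)]) simp_all
        then show ?thesis
          using that by (intro inj_onD[OF Winj]) simp_all
      qed
      then show ?thesis
        unfolding P_def inj_on_def ball_simps by metis
    qed
    obtain k where k: "k holomorphic_on (g ` P)" "\<And>z. z \<in> P \<Longrightarrow> k (g z) = z"
      by (rule holomorphic_has_inverse[OF hol P gi]) blast
    have gP: "open (g ` P)"
      by (rule open_mapping_thm3[OF hol P gi])
    have kP: "k w \<in> P" "g (k w) = w" if "w \<in> g ` P" for w
      using that k(2) by auto
    define V where "V = {y \<in> A. a y \<in> g ` P}"
    \<comment> \<open>In coordinates the section is \<open>k\<close>: leave \<open>N\<close> through
      \<open>a\<close>, invert \<open>g\<close>, return to \<open>M\<close> through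
      \<open>\<phi>\<close>.\<close>
    define s where "s = inv_into U \<phi> \<circ> k \<circ> a"
    have V: "openin (sf_top N) V"
      unfolding V_def by (rule chart_open_preimage[OF N A(1) gP])
    have Px: "\<phi> x \<in> P" and gx: "g (\<phi> x) = a (h x)"
      using U(2) Wx inv by (auto simp: P_def g_def)
    have hV: "h x \<in> V"
      using A(2) Px gx by (force simp: V_def)
    have sx: "s (h x) = x"
      using k(2)[OF Px] gx inv[OF U(2)] by (simp add: s_def)
    have sU: "s y \<in> U \<inter> W" "\<phi> (s y) = k (a y)" if y: "y \<in> V" for y
    proof -
      obtain z where z: "z \<in> U" "z \<in> W" "k (a y) = \<phi> z"
        using kP(1)[of "a y"] y unfolding V_def P_def by blast
      then show "s y \<in> U \<inter> W" "\<phi> (s y) = k (a y)"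
        using inv by (simp_all add: s_def)
    qed
    have hs: "h (s y) = y" if y: "y \<in> V" for y
    proof -
      have "a (h (s y)) = g (\<phi> (s y))"
        using sU(1)[OF y] inv by (simp add: g_def)
      also have "\<dots> = a y"
        using sU(2)[OF y] kP(2) y by (simp add: V_def)
      finally show ?thesis
        using cA(4) WA sU(1)[OF y] y by (auto simp: V_def inj_on_def)
    qed
    \<comment> \<open>Continuity of \<open>s\<close> reduces to that of \<open>k\<close>, because
      \<open>\<phi> (s y) = k (a y)\<close> on \<open>V\<close>.\<close>
    have "openin (sf_top N) {y \<in> V. s y \<in> Z}" if Z: "openin (sf_top M) Z" for Z
    proof -
      define T where "T = \<phi> ` (U \<inter> Z)"
      have "continuous_on (g ` P) k"
        by (rule holomorphic_on_imp_continuous_on[OF k(1)])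
      then have "open (k -` T \<inter> g ` P)"
        using gP chart_open_image[OF M U(1) Z] by (simp add: continuous_on_open_vimage T_def)
      then have "openin (sf_top N) {y \<in> A. a y \<in> k -` T \<inter> g ` P}"
        by (rule chart_open_preimage[OF N A(1)])
      moreover have "{y \<in> A. a y \<in> k -` T \<inter> g ` P} = {y \<in> V. s y \<in> Z}"
      proof -
        have "k (a y) \<in> T \<longleftrightarrow> s y \<in> Z" if "y \<in> V" for y
          using sU[OF that] cU(4) unfolding T_def
          by (metis IntD1 IntI image_iff inv IntD2)
        then show ?thesis
          by (auto simp: V_def)
      qed
      ultimately show ?thesis by simp
    qed
    moreover have "topspace (subtopology (sf_top N) V) = V"
      using openin_subset[OF V] by auto
    ultimately have sc: "continuous_map (subtopology (sf_top N) V) (sf_top M) s"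
      using sU(1) cU(5) V by (auto simp: continuous_map_def openin_open_subtopology)
    \<comment> \<open>In the coordinates \<open>b\<close> and \<open>\<phi>\<close> the section is
      \<open>k\<close> after a transition map, on the part of \<open>B\<close> inside
      \<open>V\<close>.\<close>
    have "complex_differentiable_at N M s y" if y: "y \<in> V" for y
    proof (rule complex_differentiable_atI[where A = U and a = \<phi>])
      show "(U, \<phi>) \<in> sf_atlas M" "s y \<in> U"
        using U(1) sU(1)[OF y] by auto
      fix B b assume B: "(B, b) \<in> sf_atlas N" "y \<in> B"
      have yA: "y \<in> A" and yg: "a y \<in> g ` P"
        using y by (auto simp: V_def)
      have iB: "inv_into B b (b z) = z" if "z \<in> B" for z
        using chartD(4)[OF N B(1)] that by simp
      have "(a \<circ> inv_into B b) field_differentiable at (b y)"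
        by (rule chart_transition[OF N B(1) A(1) B(2) yA])
      moreover have "k field_differentiable at (a y)"
        by (rule holomorphic_on_imp_differentiable_at[OF k(1) gP yg])
      ultimately have "(k \<circ> (a \<circ> inv_into B b)) field_differentiable at (b y)"
        using iB[OF B(2)] by (intro field_differentiable_compose) auto
      then obtain D where D: "((k \<circ> (a \<circ> inv_into B b)) has_field_derivative D) (at (b y))"
        unfolding field_differentiable_def by blast
      have o: "open (b ` (B \<inter> V))"
        by (rule chart_open_image[OF N B(1) V])
      have "(k \<circ> (a \<circ> inv_into B b)) w = (\<phi> \<circ> s \<circ> inv_into B b) w" if "w \<in> b ` (B \<inter> V)" for w
        using that iB sU(2) by auto
      then have "((\<phi> \<circ> s \<circ> inv_into B b) has_field_derivative D) (at (b y))"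
        using has_field_derivative_transform_within_open[OF D o] B(2) y by blast
      then show "(\<phi> \<circ> s \<circ> inv_into B b) field_differentiable at (b y)"
        unfolding field_differentiable_def by blast
    qed
    with V hV sc sx hs show ?thesis
      by (intro exI[of _ V] exI[of _ s]) simp
  qed
  then show ?thesis
    unfolding local_biholomorphism_def using c d by blast
qed

section \<open>Plane domains, slices and the projection to the second factor\<close>

lemma riemann_surface_plane_domain:
  assumes "open D" "connected D" "D \<noteq> {}"
  shows "riemann_surface (plane_domain D)"
proof -
  have "inv_into D (\<lambda>z. z) w = w" if "w \<in> D" for w
    using inv_into_f_f[of "\<lambda>z. z" D w] that by simp
  then have "((\<lambda>z. z) \<circ> inv_into D (\<lambda>z. z)) holomorphic_on D"
    by (intro holomorphic_transform[OF holomorphic_on_ident]) simp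
  then show ?thesis
    using assms by (simp add: riemann_surface_def plane_domain_def connectedin_def[symmetric]
        connected_space_subtopology Hausdorff_space_subtopology openin_subtopology_self
        subtopology_subtopology homeomorphic_map_id[unfolded id_def])
qed

lemma riemann_surface_nonempty: "riemann_surface M \<Longrightarrow> topspace (sf_top M) \<noteq> {}"
  unfolding riemann_surface_def by blast

lemma sp_points_product_space:
  "sp_points (product_space M N) = topspace (sf_top M) \<times> topspace (sf_top N)"
  by (simp add: product_space_def)

lemma topspace_plane_domain: "topspace (sf_top (plane_domain D)) = D"
  by (simp add: plane_domain_def)

text \<open>Restricted to the directions \<open>(0, k)\<close>, the complex linear derivative is
  multiplication by \<open>d\<close>, which is complex differentiability in the second
  variable.\<close>

lemma sp_hol_slice:
  assumes M: "riemann_surface M" and N: "riemann_surface N" and x: "x \<in> topspace (sf_top M)"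
    and W: "openin (sf_top N) W" "W \<subseteq> {y. (x, y) \<in> V}"
    and f: "sp_hol (product_space M N) V f"
  shows "sp_hol (surface_space N) W (\<lambda>y. f (x, y))"
  unfolding sp_hol_surface_space[OF N W(1)]
proof (intro ballI allI impI)
  fix y B \<psi> assume y: "y \<in> W" and B: "(B, \<psi>) \<in> sf_atlas N" "y \<in> B"
  obtain A \<phi> where A: "(A, \<phi>) \<in> sf_atlas M" "x \<in> A"
    using chart_exists M x by metis
  define F where "F = (\<lambda>(a, b). f (inv_into A \<phi> a, inv_into B \<psi> b))"
  have "holomorphic2_at M N f (x, y)"
    using f y W(2) unfolding sp_hol_product_space by blast
  then obtain c d where "(F has_derivative (\<lambda>(h, k). c * h + d * k)) (at (\<phi> x, \<psi> y))"
    unfolding F_def by (rule holomorphic2_atE[OF _ A(1) B(1) A(2) B(2)]) (rule that[unfolded F_def])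
  moreover have "((\<lambda>b. (\<phi> x, b)) has_derivative (\<lambda>k. (0, k))) (at (\<psi> y))"
    by (auto intro!: derivative_eq_intros)
  ultimately have "((\<lambda>b. F (\<phi> x, b)) has_derivative (\<lambda>k. (\<lambda>(h, k). c * h + d * k) (0, k))) (at (\<psi> y))"
    by (rule has_derivative_compose[where g = F, rotated])
  then have "((\<lambda>b. f (x, inv_into B \<psi> b)) has_derivative (*) d) (at (\<psi> y))"
    using chartD(4)[OF M A(1)] A(2) by (simp add: F_def)
  then show "((\<lambda>y. f (x, y)) \<circ> inv_into B \<psi>) field_differentiable at (\<psi> y)"
    unfolding field_differentiable_def has_field_derivative_def o_def by blast
qed

text \<open>The fibres are copies of \<open>M\<close>, so this is no product of local
  biholomorphisms. A pullback has a derivative with first coefficient 0; conversely \<open>f\<close>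
  is recovered from its pullback on the slice over any single point of \<open>M\<close>.\<close>

lemma quotient_hol_map_snd:
  assumes M: "riemann_surface M" and N: "riemann_surface N"
  shows "quotient_hol_map (product_space M N) (surface_space N) snd"
proof -
  have ne: "topspace (sf_top M) \<noteq> {}"
    by (rule riemann_surface_nonempty[OF M])
  have q: "quotient_map (prod_topology (sf_top M) (sf_top N)) (sf_top N) snd"
    using ne by (intro continuous_open_imp_quotient_map open_map_snd continuous_map_snd) simp
  have "sp_hol (surface_space N) V f =
      sp_hol (product_space M N) {w \<in> topspace (sf_top M) \<times> topspace (sf_top N). snd w \<in> V} (f \<circ> snd)"
    if V: "openin (sf_top N) V" for V f
  proof
    assume f: "sp_hol (surface_space N) V f"
    show "sp_hol (product_space M N) {w \<in> topspace (sf_top M) \<times> topspace (sf_top N). snd w \<in> V} (f \<circ> snd)"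
      unfolding sp_hol_product_space
    proof
      fix w assume "w \<in> {w \<in> topspace (sf_top M) \<times> topspace (sf_top N). snd w \<in> V}"
      then obtain x y where w: "w = (x, y)" "y \<in> V"
        by auto
      show "holomorphic2_at M N (f \<circ> snd) w"
        unfolding w(1)
      proof (rule holomorphic2_atI)
        fix A \<phi> B \<psi> assume AB: "(A, \<phi>) \<in> sf_atlas M" "(B, \<psi>) \<in> sf_atlas N" "x \<in> A" "y \<in> B"
        have "(f \<circ> inv_into B \<psi>) field_differentiable at (\<psi> y)"
          using f w(2) AB(2,4) unfolding sp_hol_surface_space[OF N V] by blast
        then obtain d where d: "((f \<circ> inv_into B \<psi>) has_derivative (*) d) (at (\<psi> y))"
          unfolding field_differentiable_def has_field_derivative_def by blast
        have "(snd has_derivative snd) (at (\<phi> x, \<psi> y))"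
          by (auto intro!: derivative_eq_intros)
        from has_derivative_compose[OF this, of "f \<circ> inv_into B \<psi>" "(*) d"] d
        have "((\<lambda>w. (f \<circ> inv_into B \<psi>) (snd w)) has_derivative (\<lambda>w. d * snd w)) (at (\<phi> x, \<psi> y))"
          by simp
        then show "\<exists>c d. ((\<lambda>(a, b). (f \<circ> snd) (inv_into A \<phi> a, inv_into B \<psi> b)) has_derivative
            (\<lambda>(h, k). c * h + d * k)) (at (\<phi> x, \<psi> y))"
          by (intro exI[of _ 0] exI[of _ d]) (simp add: case_prod_unfold)
      qed
    qed
  next
    assume f: "sp_hol (product_space M N) {w \<in> topspace (sf_top M) \<times> topspace (sf_top N). snd w \<in> V} (f \<circ> snd)"
    obtain x where x: "x \<in> topspace (sf_top M)"
      using ne by blast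
    have "V \<subseteq> {y. (x, y) \<in> {w \<in> topspace (sf_top M) \<times> topspace (sf_top N). snd w \<in> V}}"
      using x openin_subset[OF V] by auto
    from sp_hol_slice[OF M N x V this f] show "sp_hol (surface_space N) V f"
      by simp
  qed
  with q show ?thesis
    by (simp add: quotient_hol_map_def product_space_def surface_space_def)
qed

section \<open>The compact factor and the maximum principle\<close>

text \<open>By compactness the norm of \<open>f\<close> has a maximum at some \<open>m\<close>. The
  set where \<open>f\<close> equals \<open>f m\<close> is closed by continuity and open by the
  maximum modulus principle in a chart, hence everything by connectedness.\<close>

lemma sp_hol_compact_constant:
  assumes R: "compact_riemann_surface R" and f: "sp_hol (surface_space R) (topspace (sf_top R)) f"
    and xy: "x \<in> topspace (sf_top R)" "y \<in> topspace (sf_top R)"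
  shows "f x = f y"
proof -
  let ?T = "sf_top R"
  have M: "riemann_surface R" and comp: "compact_space ?T" and conn: "connected_space ?T"
    using R by (auto simp: compact_riemann_surface_def riemann_surface_def)
  have hol: "(f \<circ> inv_into U \<phi>) holomorphic_on \<phi> ` U" if U: "(U, \<phi>) \<in> sf_atlas R" for U \<phi>
  proof -
    have "U \<inter> topspace ?T = U"
      using chartD(5)[OF M U] by blast
    then show ?thesis
      using f U unfolding surface_space_def cspace.simps ball_pair by metis
  qed
  \<comment> \<open>\<open>sp_hol\<close> only mentions holomorphy in charts; continuity on the
    whole surface is glued together from them.\<close>
  have pre: "openin ?T {x \<in> topspace ?T. f x \<in> T}" if T: "open T" for T
  proof (subst openin_subopen, intro ballI)
    fix z assume "z \<in> {x \<in> topspace ?T. f x \<in> T}"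
    then have z: "z \<in> topspace ?T" "f z \<in> T" by auto
    obtain U \<phi> where U: "(U, \<phi>) \<in> sf_atlas R" "z \<in> U"
      using chart_exists M z(1) by metis
    have inv: "inv_into U \<phi> (\<phi> w) = w" if "w \<in> U" for w
      using chartD(4)[OF M U(1)] that by simp
    have "open ((f \<circ> inv_into U \<phi>) -` T \<inter> \<phi> ` U)"
      using T holomorphic_on_imp_continuous_on[OF hol[OF U(1)]] chartD(2)[OF M U(1)]
      by (simp add: continuous_on_open_vimage o_def)
    then have "openin ?T {w \<in> U. \<phi> w \<in> (f \<circ> inv_into U \<phi>) -` T \<inter> \<phi> ` U}"
      by (rule chart_open_preimage[OF M U(1)])
    moreover have "{w \<in> U. \<phi> w \<in> (f \<circ> inv_into U \<phi>) -` T \<inter> \<phi> ` U} = {w \<in> U. f w \<in> T}"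
      using inv by auto (metis inv)
    ultimately show "\<exists>S. openin ?T S \<and> z \<in> S \<and> S \<subseteq> {x \<in> topspace ?T. f x \<in> T}"
      using z(2) U(2) chartD(5)[OF M U(1)] by (intro exI[of _ "{w \<in> U. f w \<in> T}"]) auto
  qed
  then have cont: "continuous_map ?T euclidean f"
    by (auto simp: continuous_map_def)
  then have "compactin euclidean (f ` topspace ?T)"
    using comp image_compactin unfolding compact_space_def by blast
  then have "compact (f ` topspace ?T)"
    by simp
  then obtain m where m: "m \<in> topspace ?T" "\<And>z. z \<in> topspace ?T \<Longrightarrow> norm (f z) \<le> norm (f m)"
  proof -
    have "f ` topspace ?T \<noteq> {}"
      using xy by blast
    moreover have "continuous_on (f ` topspace ?T) norm"
      by (intro continuous_intros)
    ultimately have "\<exists>w \<in> f ` topspace ?T. \<forall>v \<in> f ` topspace ?T. norm v \<le> norm w"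
      using \<open>compact (f ` topspace ?T)\<close> by (intro continuous_attains_sup)
    then show thesis
      using that by blast
  qed
  define E where "E = {z \<in> topspace ?T. f z = f m}"
  have "openin ?T E"
  proof (subst openin_subopen, intro ballI)
    fix z assume "z \<in> E"
    then have z: "z \<in> topspace ?T" "f z = f m" by (auto simp: E_def)
    obtain U \<phi> where U: "(U, \<phi>) \<in> sf_atlas R" "z \<in> U"
      using chart_exists M z(1) by metis
    note c = chartD[OF M U(1)]
    have inv: "inv_into U \<phi> (\<phi> w) = w" if "w \<in> U" for w
      using c(4) that by simp
    \<comment> \<open>The centre of this disc is a maximum over the disc because
      \<open>f z = f m\<close> and \<open>m\<close> is a maximum over the whole surface.\<close>
    obtain e where e: "e > 0" "ball (\<phi> z) e \<subseteq> \<phi> ` U"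
      using c(2) U(2) open_contains_ball by blast
    have fz: "(f \<circ> inv_into U \<phi>) (\<phi> z) = f m"
      using z U(2) inv by simp
    have "(f \<circ> inv_into U \<phi>) constant_on ball (\<phi> z) e"
    proof (rule maximum_modulus_principle[where U = "ball (\<phi> z) e" and \<xi> = "\<phi> z"])
      show "(f \<circ> inv_into U \<phi>) holomorphic_on ball (\<phi> z) e"
        using hol[OF U(1)] e(2) by (rule holomorphic_on_subset)
      show "norm ((f \<circ> inv_into U \<phi>) w) \<le> norm ((f \<circ> inv_into U \<phi>) (\<phi> z))" if w: "w \<in> ball (\<phi> z) e" for w
      proof -
        have "inv_into U \<phi> w \<in> U"
          using w e(2) by (blast intro: inv_into_into)
        then show ?thesis
          unfolding fz using m(2) c(5) by auto
      qed
    qed (use e in auto)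
    then have const: "(f \<circ> inv_into U \<phi>) w = f m" if "w \<in> ball (\<phi> z) e" for w
      using that fz e(1) unfolding constant_on_def by (metis centre_in_ball)
    have "f w = f m" if "w \<in> U" "\<phi> w \<in> ball (\<phi> z) e" for w
      using const[OF that(2)] inv[OF that(1)] by simp
    then have "{w \<in> U. \<phi> w \<in> ball (\<phi> z) e} \<subseteq> E"
      using c(5) by (auto simp: E_def)
    then show "\<exists>S. openin ?T S \<and> z \<in> S \<and> S \<subseteq> E"
      using chart_open_preimage[OF M U(1), of "ball (\<phi> z) e"] U(2) e(1)
      by (intro exI[of _ "{w \<in> U. \<phi> w \<in> ball (\<phi> z) e}"]) simp
  qed
  moreover have "closedin ?T E"
  proof -
    have "E = {z \<in> topspace ?T. f z \<in> {f m}}"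
      by (auto simp: E_def)
    then show ?thesis
      using closedin_continuous_map_preimage[OF cont, of "{f m}"] by simp
  qed
  moreover have "E \<noteq> {}"
    using m by (auto simp: E_def)
  ultimately have "E = topspace ?T"
    using conn unfolding connected_space_clopen_in by blast
  then have "x \<in> E" "y \<in> E"
    using xy by simp_all
  then show ?thesis
    by (simp add: E_def)
qed

text \<open>Constancy on a slice contradicts separation once the slice has two points, and it has: a
  chart image is open in the plane, hence not a single point.\<close>

lemma not_holomorphically_separable_product_compact:
  assumes M: "riemann_surface M" and R: "compact_riemann_surface R"
  shows "\<not> holomorphically_separable (product_space M R)"
proof
  assume sep: "holomorphically_separable (product_space M R)"
  have N: "riemann_surface R"
    using R by (simp add: compact_riemann_surface_def)
  obtain x where x: "x \<in> topspace (sf_top M)"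
    using riemann_surface_nonempty[OF M] by blast
  obtain y where y: "y \<in> topspace (sf_top R)"
    using riemann_surface_nonempty[OF N] by blast
  obtain U \<phi> where U: "(U, \<phi>) \<in> sf_atlas R" "y \<in> U"
    using chart_exists N y by metis
  have "\<phi> ` U \<noteq> {\<phi> y}"
    using chartD(2)[OF N U(1)] not_open_singleton by metis
  then obtain y' where y': "y' \<in> U" "y' \<noteq> y"
    using U(2) by blast
  then have yR: "y' \<in> topspace (sf_top R)"
    using chartD(5)[OF N U(1)] by blast
  obtain f where f: "sp_hol (product_space M R) (topspace (sf_top M) \<times> topspace (sf_top R)) f"
      "f (x, y) \<noteq> f (x, y')"
  proof -
    have "(x, y) \<in> sp_points (product_space M R)" "(x, y') \<in> sp_points (product_space M R)" "(x, y) \<noteq> (x, y')"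
      using x y yR y'(2) by (auto simp: sp_points_product_space)
    with sep obtain f where "sp_hol (product_space M R) (sp_points (product_space M R)) f" "f (x, y) \<noteq> f (x, y')"
      unfolding holomorphically_separable_def by meson
    then show thesis
      by (intro that) (simp_all only: sp_points_product_space)
  qed
  have "topspace (sf_top R) \<subseteq> {y. (x, y) \<in> topspace (sf_top M) \<times> topspace (sf_top R)}"
    using x by blast
  from sp_hol_slice[OF M N x openin_topspace this f(1)]
  have "f (x, y) = f (x, y')"
    by (rule sp_hol_compact_constant[OF R _ y yR, of "\<lambda>y. f (x, y)"])
  with f(2) show False by simp
qed

lemma complex_differentiable_at_plane_domain:
  assumes "open D" "x \<in> D" "h x \<in> E" "h field_differentiable at x"
  shows "complex_differentiable_at (plane_domain D) (plane_domain E) h x"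
proof (rule complex_differentiable_atI[where A = E and a = "\<lambda>z. z"])
  fix U \<phi> assume "(U, \<phi>) \<in> sf_atlas (plane_domain D)"
  then have U: "U = D" "\<phi> = (\<lambda>z. z)"
    by (auto simp: plane_domain_def)
  obtain h' where h': "(h has_field_derivative h') (at x)"
    using assms(4) unfolding field_differentiable_def by blast
  have "h w = ((\<lambda>z. z) \<circ> h \<circ> inv_into U \<phi>) w" if "w \<in> D" for w
    using inv_into_f_f[of "\<lambda>z. z" D w] that by (simp add: U)
  then have "(((\<lambda>z. z) \<circ> h \<circ> inv_into U \<phi>) has_field_derivative h') (at x)"
    using has_field_derivative_transform_within_open[OF h' assms(1,2)] by blast
  then show "((\<lambda>z. z) \<circ> h \<circ> inv_into U \<phi>) field_differentiable at (\<phi> x)"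
    unfolding field_differentiable_def U by blast
qed (use assms in \<open>auto simp: plane_domain_def\<close>)

text \<open>A nonzero derivative gives local injectivity, which is what
  \<open>local_biholomorphismI\<close> asks for.\<close>

lemma local_biholomorphism_plane_domain:
  assumes D: "open D" "connected D" "D \<noteq> {}" and E: "open E" "connected E"
    and h: "h holomorphic_on D" "h ` D \<subseteq> E" and nz: "\<And>z. z \<in> D \<Longrightarrow> deriv h z \<noteq> 0"
  shows "local_biholomorphism (plane_domain D) (plane_domain E) h"
proof (rule local_biholomorphismI)
  show "riemann_surface (plane_domain D)" "riemann_surface (plane_domain E)"
    using D E h(2) by (auto intro!: riemann_surface_plane_domain)
  show "continuous_map (sf_top (plane_domain D)) (sf_top (plane_domain E)) h"
    using holomorphic_on_imp_continuous_on[OF h(1)] h(2) by (simp add: plane_domain_def image_subset_iff_funcset)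
next
  fix x assume "x \<in> topspace (sf_top (plane_domain D))"
  then have x: "x \<in> D"
    by (simp add: topspace_plane_domain)
  then show "complex_differentiable_at (plane_domain D) (plane_domain E) h x"
    using holomorphic_on_imp_differentiable_at[OF h(1) D(1) x] h(2)
    by (intro complex_differentiable_at_plane_domain D(1)) auto
  obtain r where "r > 0" "ball x r \<subseteq> D" "inj_on h (ball x r)"
    using has_complex_derivative_locally_injective[OF h(1) x D(1) nz[OF x]] by blast
  then show "\<exists>W. openin (sf_top (plane_domain D)) W \<and> x \<in> W \<and> inj_on h W"
    using D(1) by (intro exI[of _ "ball x r"]) (auto simp: plane_domain_def openin_open_eq)
qed

section \<open>Orbits and fibres\<close>

text \<open>The action laws are demanded only on \<open>A\<close>, because the elements of
  \<open>Bij\<close> are \<open>undefined\<close> off their carrier, so that the neutral deck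
  transformation is the identity only on the surface.\<close>

lemma orbit_of_eq_iff:
  fixes act :: "'g::group_add \<Rightarrow> 'a \<Rightarrow> 'a"
  assumes zero: "\<And>x. x \<in> A \<Longrightarrow> act 0 x = x"
    and add: "\<And>g h x. x \<in> A \<Longrightarrow> act (g + h) x = act g (act h x)"
    and xy: "x \<in> A" "y \<in> A"
  shows "orbit_of act x = orbit_of act y \<longleftrightarrow> (\<exists>g. y = act g x)"
proof
  assume "orbit_of act x = orbit_of act y"
  moreover have "y \<in> orbit_of act y"
    unfolding orbit_of_def using zero[OF xy(2)] by (metis rangeI)
  ultimately show "\<exists>g. y = act g x"
    by (auto simp: orbit_of_def)
next
  assume "\<exists>g. y = act g x"
  then obtain g where g: "y = act g x" ..
  show "orbit_of act x = orbit_of act y"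
  proof (intro equalityI subsetI)
    fix z assume "z \<in> orbit_of act x"
    then obtain h where "z = act h x"
      by (auto simp: orbit_of_def)
    then have "z = act (h - g) y"
      using add[OF xy(1), of "h - g" g] g by simp
    then show "z \<in> orbit_of act y"
      by (simp add: orbit_of_def)
  next
    fix z assume "z \<in> orbit_of act y"
    then obtain h where "z = act h y"
      by (auto simp: orbit_of_def)
    then have "z = act (h + g) x"
      using add[OF xy(1)] g by simp
    then show "z \<in> orbit_of act x"
      by (simp add: orbit_of_def)
  qed
qed

text \<open>The parameter \<open>c\<close> treats integer and complex translations at once.
  Translating an orbit of the diagonal action gives the orbit of the translated point, so equality
  of the outer orbits unfolds to one translation and one diagonal step.\<close>

lemma translated_orbit_eq_iff:
  fixes c :: "'g::group_add \<Rightarrow> complex" and \<alpha> :: "int \<Rightarrow> 'b \<Rightarrow> 'b"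
  assumes zero: "\<And>x. x \<in> T \<Longrightarrow> \<alpha> 0 x = x"
    and add: "\<And>m n x. x \<in> T \<Longrightarrow> \<alpha> (m + n) x = \<alpha> m (\<alpha> n x)"
    and c: "c 0 = 0" "\<And>g h. c (g + h) = c g + c h"
    and xy: "x \<in> T" "y \<in> T"
  shows "orbit_of (\<lambda>g. translate (c g)) (orbit_of (diagonal_action \<alpha>) (z, x)) =
      orbit_of (\<lambda>g. translate (c g)) (orbit_of (diagonal_action \<alpha>) (w, y)) \<longleftrightarrow>
    (\<exists>g m. w = z + c g + of_int m \<and> y = \<alpha> m x)"
proof -
  let ?d = "diagonal_action \<alpha>"
  have d: "orbit_of ?d u = orbit_of ?d v \<longleftrightarrow> (\<exists>m. v = ?d m u)" if "u \<in> UNIV \<times> T" "v \<in> UNIV \<times> T" for u v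
    using that
  proof (rule orbit_of_eq_iff[rotated 2])
    show "?d 0 u = u" if "u \<in> UNIV \<times> T" for u
      using that zero by (auto simp: diagonal_action_def)
    show "?d (m + n) u = ?d m (?d n u)" if "u \<in> UNIV \<times> T" for m n u
      using that add by (auto simp: diagonal_action_def ac_simps)
  qed
  \<comment> \<open>\<open>translate\<close> is defined on arbitrary sets of pairs, so here the
    action laws hold everywhere and \<open>A\<close> can be \<open>UNIV\<close>.\<close>
  have "orbit_of (\<lambda>g. translate (c g)) (orbit_of ?d (z, x)) =
      orbit_of (\<lambda>g. translate (c g)) (orbit_of ?d (w, y)) \<longleftrightarrow>
    (\<exists>g. orbit_of ?d (w, y) = translate (c g) (orbit_of ?d (z, x)))"
    by (rule orbit_of_eq_iff[where A = UNIV])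
      (auto simp: c translate_def image_image case_prod_unfold ac_simps)
  also have "\<dots> \<longleftrightarrow> (\<exists>g. orbit_of ?d (z + c g, x) = orbit_of ?d (w, y))"
    unfolding translate_orbit by metis
  also have "\<dots> \<longleftrightarrow> (\<exists>g m. w = z + c g + of_int m \<and> y = \<alpha> m x)"
    using xy by (subst d) (auto simp: diagonal_action_def)
  finally show ?thesis .
qed

text \<open>The action laws come from \<open>\<alpha>\<close> being a homomorphism into a group of
  maps under composition. Two points of a fibre differ by a deck transformation, as the covering is
  normal, and every deck transformation is some \<open>\<alpha> m\<close>, as
  \<open>\<alpha>\<close> is onto.\<close>

lemma deck_action:
  assumes action: "\<alpha> \<in> iso integer_group (deck_group X p)" and cov: "normal_covering X Y p"
    and x: "x \<in> topspace X"
  shows "\<alpha> 0 x = x" "\<alpha> (m + n) x = \<alpha> m (\<alpha> n x)"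
    and "y \<in> topspace X \<Longrightarrow> p x = p y \<longleftrightarrow> (\<exists>m. y = \<alpha> m x)"
proof -
  have car: "carrier (deck_group X p) =
      {f \<in> Bij (topspace X). homeomorphic_map X X f \<and> (\<forall>x\<in>topspace X. p (f x) = p x)}"
    by (simp add: deck_group_def)
  have mem: "\<alpha> m \<in> carrier (deck_group X p)" for m
    using action by (auto simp: iso_def hom_def)
  then have bij: "\<alpha> m \<in> Bij (topspace X)" and p: "\<And>x. x \<in> topspace X \<Longrightarrow> p (\<alpha> m x) = p x" for m
    by (simp_all add: car)
  have "\<alpha> (m + n) = \<alpha> m \<otimes>\<^bsub>deck_group X p\<^esub> \<alpha> n" for m n
    using action by (simp add: iso_def hom_def)
  then have comp: "\<alpha> (m + n) x = \<alpha> m (\<alpha> n x)" if "x \<in> topspace X" for m n x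
    using bij that by (simp add: deck_group_def BijGroup_def compose_def)
  show "\<alpha> (m + n) x = \<alpha> m (\<alpha> n x)"
    by (rule comp[OF x])
  have bb: "bij_betw (\<alpha> 0) (topspace X) (topspace X)"
    using bij[of 0] by (simp add: Bij_def)
  \<comment> \<open>An idempotent injective map of the surface into itself is the identity.\<close>
  have "\<alpha> 0 (\<alpha> 0 x) = \<alpha> 0 x"
    using comp[OF x, of 0 0] by simp
  moreover have "\<alpha> 0 x \<in> topspace X"
    using bb x by (rule bij_betwE[THEN bspec])
  ultimately show "\<alpha> 0 x = x"
    using bij_betw_imp_inj_on[OF bb] x by (auto dest: inj_onD)
  show "p x = p y \<longleftrightarrow> (\<exists>m. y = \<alpha> m x)" if y: "y \<in> topspace X"
  proof
    assume "p x = p y"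
    then obtain f where f: "f \<in> carrier (deck_group X p)" "f x = y"
      using cov x y unfolding normal_covering_def by meson
    moreover have "range \<alpha> = carrier (deck_group X p)"
      using action by (simp add: iso_def bij_betw_def)
    ultimately show "\<exists>m. y = \<alpha> m x"
      by (metis imageE)
  qed (use p x in auto)
qed

text \<open>\<open>U\<close> is the sheet through \<open>x\<close> over an evenly covered
  neighbourhood of \<open>p x\<close>.\<close>

lemma covering_locally_injective:
  assumes "covering_map X Y p" "x \<in> topspace X"
  obtains U where "openin X U" "x \<in> U" "inj_on p U"
proof -
  have "p x \<in> topspace Y"
    using assms by (auto simp: covering_map_def)
  moreover have "\<forall>y \<in> topspace Y. \<exists>V. openin Y V \<and> y \<in> V \<and>
        (\<exists>\<U>. \<Union>\<U> = {x \<in> topspace X. p x \<in> V} \<and> (\<forall>U\<in>\<U>. openin X U) \<and> pairwise disjnt \<U> \<and>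
          (\<forall>U\<in>\<U>. homeomorphic_map (subtopology X U) (subtopology Y V) p))"
    using assms(1) unfolding covering_map_def by (elim conjE)
  ultimately have "\<exists>V. openin Y V \<and> p x \<in> V \<and>
        (\<exists>\<U>. \<Union>\<U> = {x \<in> topspace X. p x \<in> V} \<and> (\<forall>U\<in>\<U>. openin X U) \<and> pairwise disjnt \<U> \<and>
          (\<forall>U\<in>\<U>. homeomorphic_map (subtopology X U) (subtopology Y V) p))"
    by (rule bspec[rotated])
  then obtain V \<U> where V: "p x \<in> V" "\<Union>\<U> = {x \<in> topspace X. p x \<in> V}"
      "\<And>U. U \<in> \<U> \<Longrightarrow> openin X U"
      "\<And>U. U \<in> \<U> \<Longrightarrow> homeomorphic_map (subtopology X U) (subtopology Y V) p"
    by (elim exE conjE) simp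
  then obtain U where U: "U \<in> \<U>" "x \<in> U"
    using assms(2) by blast
  have "inj_on p (topspace (subtopology X U))"
    using homeomorphic_imp_injective_map[OF V(4)[OF U(1)]] .
  moreover have "topspace (subtopology X U) = U"
    using openin_subset[OF V(3)[OF U(1)]] by auto
  ultimately show thesis
    using that V(3) U by metis
qed

section \<open>The exponential covering of the punctured disc\<close>

lemma exp_half_plane_image:
  "(\<lambda>z. exp (2 * of_real pi * \<i> * z)) ` {z. Im z > 0} = ball 0 1 - {0}"
proof
  show "(\<lambda>z. exp (2 * of_real pi * \<i> * z)) ` {z. Im z > 0} \<subseteq> ball 0 1 - {0}"
    by (auto simp: mult_pos_pos)
  show "ball 0 1 - {0} \<subseteq> (\<lambda>z. exp (2 * of_real pi * \<i> * z)) ` {z. Im z > 0}"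
  proof
    fix w :: complex assume "w \<in> ball 0 1 - {0}"
    then have w: "norm w < 1" "w \<noteq> 0" by auto
    \<comment> \<open>The real part of \<open>2 * of_real pi * \<i> * z\<close> is -2 pi times
      \<open>Im z\<close>, while that of \<open>Ln w\<close> is the logarithm of
      \<open>norm w\<close>; hence \<open>norm w < 1\<close> becomes
      \<open>Im z > 0\<close>.\<close>
    define z where "z = Ln w / (2 * of_real pi * \<i>)"
    have e: "2 * of_real pi * \<i> * z = Ln w"
      by (simp add: z_def)
    have "- 2 * pi * Im z = Re (2 * of_real pi * \<i> * z)"
      by simp
    also have "\<dots> < 0"
      unfolding e using w by simp
    finally have "Im z > 0"
      by (simp add: zero_less_mult_iff)
    with e w show "w \<in> (\<lambda>z. exp (2 * of_real pi * \<i> * z)) ` {z. Im z > 0}"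
      by (intro image_eqI[of _ _ z]) simp_all
  qed
qed

text \<open>The factor 2 pi i rescales the period of \<open>exp\<close> to 1, so that the fibres are
  the orbits of integer translation.\<close>

lemma exp_period_eq_iff:
  "exp (2 * of_real pi * \<i> * z) = exp (2 * of_real pi * \<i> * w) \<longleftrightarrow> (\<exists>n::int. w = z + of_int n)"
proof -
  have "2 * of_real pi * \<i> * w = 2 * of_real pi * \<i> * z + (of_int (2 * n) * pi) * \<i> \<longleftrightarrow> w = z + of_int n"
    for n :: int
  proof -
    have "2 * of_real pi * \<i> * z + (of_int (2 * n) * pi) * \<i> = 2 * of_real pi * \<i> * (z + of_int n)"
      by (simp add: algebra_simps)
    then show ?thesis
      by simp
  qed
  \<comment> \<open>\<open>exp_eq\<close> expresses the left argument through the right one; here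
    \<open>w\<close> is expressed through \<open>z\<close>, so the sides are exchanged.\<close>
  moreover have "exp (2 * of_real pi * \<i> * z) = exp (2 * of_real pi * \<i> * w) \<longleftrightarrow>
      exp (2 * of_real pi * \<i> * w) = exp (2 * of_real pi * \<i> * z)"
    by (rule eq_commute)
  ultimately show ?thesis
    unfolding exp_eq by simp
qed

lemma riemann_surface_standard:
  "riemann_surface upper_half_plane" "riemann_surface complex_plane" "riemann_surface punctured_disc"
proof -
  have "{z::complex. Im z > 0} \<noteq> {}"
    by (auto intro!: exI[of _ \<i>])
  then show "riemann_surface upper_half_plane"
    unfolding upper_half_plane_def
    by (intro riemann_surface_plane_domain open_halfspace_Im_gt convex_connected convex_halfspace_Im_gt)
  show "riemann_surface complex_plane"
    unfolding complex_plane_def by (intro riemann_surface_plane_domain) auto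
  have "(1/2 :: complex) \<in> ball 0 1 - {0}"
    by simp
  then have "ball 0 1 - {0 :: complex} \<noteq> {}"
    by blast
  then show "riemann_surface punctured_disc"
    unfolding punctured_disc_def
    by (intro riemann_surface_plane_domain open_delete connected_open_delete open_ball connected_ball) simp_all
qed

lemma local_biholomorphism_exp:
  "local_biholomorphism upper_half_plane punctured_disc (\<lambda>z. exp (2 * of_real pi * \<i> * z))"
  unfolding upper_half_plane_def punctured_disc_def
proof (rule local_biholomorphism_plane_domain)
  show "{z::complex. Im z > 0} \<noteq> {}"
    by (auto intro!: exI[of _ \<i>])
  show "deriv (\<lambda>z. exp (2 * of_real pi * \<i> * z)) z \<noteq> 0" for z
  proof -
    have "((\<lambda>z. exp (2 * of_real pi * \<i> * z)) has_field_derivative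
        exp (2 * of_real pi * \<i> * z) * (2 * of_real pi * \<i>)) (at z)"
      by (auto intro!: derivative_eq_intros)
    then show ?thesis
      using DERIV_imp_deriv by fastforce
  qed
  show "connected (ball 0 1 - {0 :: complex})"
    by (intro connected_open_delete open_ball connected_ball) simp_all
qed (auto intro!: holomorphic_intros open_halfspace_Im_gt convex_connected convex_halfspace_Im_gt
    open_delete simp: exp_half_plane_image)

theorem proposition5p2:
  fixes R :: "'a surface" and g :: nat and x0 :: 'a and N :: "(real \<Rightarrow> 'a) set set"
    and S :: "'b surface" and p :: "'b \<Rightarrow> 'a" and y0 :: 'b
    and \<alpha> :: "int \<Rightarrow> 'b \<Rightarrow> 'b"
    and X Xstar :: "(complex \<times> 'b) set cspace"
    and XmodZ XstarmodC :: "(complex \<times> 'b) set set cspace"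
  assumes R: "compact_riemann_surface R" "has_genus R g" "g \<ge> 2"
    and N: "x0 \<in> topspace (sf_top R)" "N \<lhd> fundamental_group (sf_top R) x0"
      "fundamental_group (sf_top R) x0 Mod N \<cong> integer_group"
    and S: "riemann_surface S" "hol_map (surface_space S) (surface_space R) p"
      "normal_covering (sf_top S) (sf_top R) p"
    and corresponds: "y0 \<in> topspace (sf_top S)" "p y0 = x0"
      "induced_subgroup (sf_top S) y0 (sf_top R) p = N"
    and action: "\<alpha> \<in> iso integer_group (deck_group (sf_top S) p)"
  defines "X \<equiv> twisted_product upper_half_plane S \<alpha>"
    and "XmodZ \<equiv> quotient_space X (\<lambda>m::int. translate (complex_of_real (real_of_int m)))"
    and "Xstar \<equiv> twisted_product complex_plane S \<alpha>"
    and "XstarmodC \<equiv> quotient_space Xstar translate"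
  shows "biholomorphic XmodZ (product_space punctured_disc R) \<and>
    \<not> holomorphically_separable XmodZ \<and>
    \<not> stein XmodZ \<and>
    biholomorphic XstarmodC (quotient_space (surface_space S) \<alpha>) \<and>
    biholomorphic XstarmodC (surface_space R)"
proof -
  let ?T = "topspace (sf_top S)" and ?e = "\<lambda>z::complex. exp (2 * of_real pi * \<i> * z)"
    and ?d = "diagonal_action \<alpha>"
  have rR: "riemann_surface R"
    using R(1) by (simp add: compact_riemann_surface_def)
  have cov: "covering_map (sf_top S) (sf_top R) p"
    using S(3) by (simp add: normal_covering_def)
  have p_surj: "p ` ?T = topspace (sf_top R)"
    using cov by (simp add: covering_map_def)
  have p: "local_biholomorphism S R p"
  proof (rule local_biholomorphismI[OF S(1) rR])
    show "continuous_map (sf_top S) (sf_top R) p"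
      using cov by (simp add: covering_map_def)
    show "complex_differentiable_at S R p x" if "x \<in> ?T" for x
      by (rule hol_map_complex_differentiable_at[OF S(1) rR S(2) that])
    show "\<exists>W. openin (sf_top S) W \<and> x \<in> W \<and> inj_on p W" if "x \<in> ?T" for x
      using covering_locally_injective[OF cov that] by metis
  qed
  note act = deck_action[OF action S(3)]

  \<comment> \<open>The passage from the product straight to the iterated orbit space, for a family
    \<open>c\<close> of translations.\<close>
  let ?q = "\<lambda>c. orbit_of (\<lambda>g. translate (c g)) \<circ> orbit_of ?d"
  have qZ: "quotient_hol_map (product_space upper_half_plane S) XmodZ
      (?q (\<lambda>m::int. complex_of_real (real_of_int m)))"
    unfolding XmodZ_def X_def twisted_product_def
    by (rule quotient_hol_map_compose[OF quotient_hol_map_orbit_of quotient_hol_map_orbit_of])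
  have qC: "quotient_hol_map (product_space complex_plane S) XstarmodC (?q (\<lambda>c. c))"
    unfolding XstarmodC_def Xstar_def twisted_product_def
    by (rule quotient_hol_map_compose[OF quotient_hol_map_orbit_of quotient_hol_map_orbit_of])
  have "quotient_hol_map (product_space upper_half_plane S) (product_space punctured_disc R) (map_prod ?e p)"
    by (intro quotient_hol_map_map_prod riemann_surface_standard S(1) rR local_biholomorphism_exp p p_surj)
      (simp add: upper_half_plane_def punctured_disc_def topspace_plane_domain exp_half_plane_image)
  with qZ have bZ: "biholomorphic XmodZ (product_space punctured_disc R)"
  proof (rule biholomorphic_same_fibres[OF hol_local_product_space[OF riemann_surface_standard(1) S(1)]])
    fix u v :: "complex \<times> 'b"
    assume uv: "u \<in> sp_points (product_space upper_half_plane S)"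
      "v \<in> sp_points (product_space upper_half_plane S)"
    obtain z x w y where zw: "u = (z, x)" "v = (w, y)"
      by (metis surj_pair)
    then have x: "x \<in> ?T" and y: "y \<in> ?T"
      using uv by (simp_all add: sp_points_product_space)
    have "?q (\<lambda>m::int. complex_of_real (real_of_int m)) u = ?q (\<lambda>m. complex_of_real (real_of_int m)) v \<longleftrightarrow>
        (\<exists>(k::int) m. w = z + of_int k + of_int m \<and> y = \<alpha> m x)"
      using translated_orbit_eq_iff[where T = ?T and \<alpha> = \<alpha> and c = "\<lambda>m::int. complex_of_real (real_of_int m)", OF act(1,2) _ _ x y]
      by (simp add: zw)
    \<comment> \<open>The untwisting: \<open>(k, m) \<mapsto> (k + m, m)\<close> is a bijection of
      pairs of integers, so the shift of \<open>z\<close> and the deck transformation become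
      independent.\<close>
    also have "\<dots> \<longleftrightarrow> (\<exists>k::int. w = z + of_int k) \<and> (\<exists>m. y = \<alpha> m x)"
    proof
      assume "(\<exists>k::int. w = z + of_int k) \<and> (\<exists>m. y = \<alpha> m x)"
      then obtain k :: int and m where "w = z + of_int k" "y = \<alpha> m x" by blast
      then show "\<exists>(k::int) m. w = z + of_int k + of_int m \<and> y = \<alpha> m x"
        by (intro exI[of _ "k - m"] exI[of _ m]) simp
    next
      assume "\<exists>(k::int) m. w = z + of_int k + of_int m \<and> y = \<alpha> m x"
      then show "(\<exists>k::int. w = z + of_int k) \<and> (\<exists>m. y = \<alpha> m x)"
        by (metis add.assoc of_int_add)
    qed
    also have "\<dots> \<longleftrightarrow> map_prod ?e p u = map_prod ?e p v"
      using act(3)[OF x y] by (simp add: zw exp_period_eq_iff)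
    finally show "?q (\<lambda>m::int. complex_of_real (real_of_int m)) u = ?q (\<lambda>m. complex_of_real (real_of_int m)) v \<longleftrightarrow>
        map_prod ?e p u = map_prod ?e p v" .
  qed
  \<comment> \<open>Complex translations join any \<open>z\<close> to any \<open>w\<close>, whatever
    \<open>m\<close> is, so only the second coordinates count. The fibres are phrased through
    \<open>p\<close> to serve both descriptions of \<open>XstarmodC\<close>.\<close>
  have fibC: "?q (\<lambda>c. c) u = ?q (\<lambda>c. c) v \<longleftrightarrow> p (snd u) = p (snd v)"
    if uv: "u \<in> sp_points (product_space complex_plane S)" "v \<in> sp_points (product_space complex_plane S)" for u v
  proof -
    obtain z x w y where zw: "u = (z, x)" "v = (w, y)"
      by (metis surj_pair)
    then have x: "x \<in> ?T" and y: "y \<in> ?T"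
      using uv by (simp_all add: sp_points_product_space)
    have "?q (\<lambda>c. c) u = ?q (\<lambda>c. c) v \<longleftrightarrow> (\<exists>k m. w = z + k + of_int m \<and> y = \<alpha> m x)"
      using translated_orbit_eq_iff[where T = ?T and \<alpha> = \<alpha> and c = "\<lambda>c. c", OF act(1,2) _ _ x y]
      by (simp add: zw)
    also have "\<dots> \<longleftrightarrow> (\<exists>m. y = \<alpha> m x)"
    proof
      assume "\<exists>m. y = \<alpha> m x"
      then obtain m where "y = \<alpha> m x" ..
      then show "\<exists>k m. w = z + k + of_int m \<and> y = \<alpha> m x"
        by (intro exI[of _ "w - z - of_int m"] exI[of _ m]) simp
    qed blast
    also have "\<dots> \<longleftrightarrow> p (snd u) = p (snd v)"
      using act(3)[OF x y] by (simp add: zw)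
    finally show ?thesis .
  qed
  note locC = hol_local_product_space[OF riemann_surface_standard(2) S(1)]
  have "quotient_hol_map (product_space complex_plane S) (quotient_space (surface_space S) \<alpha>) (orbit_of \<alpha> \<circ> snd)"
    by (intro quotient_hol_map_compose[OF quotient_hol_map_snd] quotient_hol_map_orbit_of
        riemann_surface_standard S(1))
  with qC have bA: "biholomorphic XstarmodC (quotient_space (surface_space S) \<alpha>)"
  proof (rule biholomorphic_same_fibres[OF locC])
    fix u v :: "complex \<times> 'b"
    assume uv: "u \<in> sp_points (product_space complex_plane S)" "v \<in> sp_points (product_space complex_plane S)"
    then have x: "snd u \<in> ?T" and y: "snd v \<in> ?T"
      by (auto simp: sp_points_product_space)
    have "orbit_of \<alpha> (snd u) = orbit_of \<alpha> (snd v) \<longleftrightarrow> p (snd u) = p (snd v)"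
      unfolding act(3)[OF x y] by (rule orbit_of_eq_iff[OF act(1,2) x y])
    then show "?q (\<lambda>c. c) u = ?q (\<lambda>c. c) v \<longleftrightarrow> (orbit_of \<alpha> \<circ> snd) u = (orbit_of \<alpha> \<circ> snd) v"
      using fibC[OF uv] by simp
  qed
  \<comment> \<open>The map onto \<open>R\<close> is routed through the product of the plane with
    \<open>R\<close>: the identity times \<open>p\<close>, then the projection. Its fibres are those
    of \<open>p\<close> on second coordinates.\<close>
  have "local_biholomorphism complex_plane complex_plane (\<lambda>z. z)"
    unfolding complex_plane_def by (rule local_biholomorphism_plane_domain) auto
  then have "quotient_hol_map (product_space complex_plane S) (product_space complex_plane R) (map_prod (\<lambda>z. z) p)"
    by (intro quotient_hol_map_map_prod riemann_surface_standard S(1) rR p p_surj) simp_all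
  from quotient_hol_map_compose[OF this quotient_hol_map_snd[OF riemann_surface_standard(2) rR]]
  have bR: "biholomorphic XstarmodC (surface_space R)"
    by (rule biholomorphic_same_fibres[OF locC qC]) (use fibC in simp)
  \<comment> \<open>Separability would pass from \<open>XmodZ\<close> to a product with the compact
    \<open>R\<close>. As \<open>stein\<close> includes separability, it fails too.\<close>
  have "\<not> holomorphically_separable XmodZ"
    using holomorphically_separable_biholomorphic[OF bZ]
      not_holomorphically_separable_product_compact[OF riemann_surface_standard(3) R(1)] by blast
  with bZ bA bR show ?thesis
    by (simp add: stein_def)
qed

end
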